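(* Let $n,T$ be positive integers, let $\Theta\subseteq\mathbb{R}^n$ be a closed convex set, and let $c^*\in\Theta$. For $t=1,\dots,T$ let $X_t\subseteq\mathbb{R}^n$ be non-empty and compact and let $x_t\in X_t$ be an arbitrary (possibly suboptimal) action of the agent. Assume: the $\ell_2$-diameter of $\Theta$ is at most $D>0$; the $\ell_2$-diameter of each $X_t$ is at most $K>0$; and there is $B>0$ with $\max\{\langle c-c',x-x'\rangle : c,c'\in\Theta,\ x,x'\in X_t\}\le B$ for all $t$. Define the suboptimality losses $\ell_t(c)\coloneqq\max_{x\in X_t}\langle c,x\rangle-\langle c,x_t\rangle$ for $c\in\Theta$, and $\Delta_T\coloneqq\sum_{t=1}^T\ell_t(c^* )$. Let $\hat c_1,\dots,\hat c_T\in\Theta$ be the outputs of MetaGrad (described in the context) applied to $\ell_1,\dots,\ell_T$, and let $\hat x_t\in\arg\max_{x\in X_t}\langle\hat c_t,x\rangle$. Then $$R^{c^*}_T\coloneqq\sum_{t=1}^T\langle c^*,x_t-\hat x_t\rangle\le\tilde R^{c^*}_T\coloneqq\sum_{t=1}^T\langle\hat c_t-c^*,\hat x_t-x_t\rangle=O\!\left(Bn\ln\!\left(\frac{DKT}{Bn}\right)+\sqrt{\Delta_T\,Bn\ln\!\left(\frac{DKT}{Bn}\right)}\right),$$ where the $O$ hides an absolute constant.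
   Context: MetaGrad on $\mathcal{W}=\Theta$ (diameter $W=D$), with subgradient bound $G=K$ and $H=B$: let $\mathcal{G}=\{\eta_i=\frac{2^{-i}}{5H}: i=0,1,\dots,\lceil\frac12\log_2T\rceil\}$, and initial weights $p^{\eta_i}_1=\frac{C}{(i+1)(i+2)}$ with $C=1+\frac{1}{1+\lceil\frac12\log_2T\rceil}$. For each $\eta\in\mathcal{G}$ an "$\eta$-expert" runs Online Newton Step (ONS) on $\Theta$ producing $w^\eta_t$, with losses $f^\eta_t(w)=-\eta\langle w_t-w,g_t\rangle+\eta^2\langle w_t-w,g_t\rangle^2$. In round $t$: MetaGrad plays $w_t=\frac{\sum_{\eta\in\mathcal{G}}\eta p^\eta_t w^\eta_t}{\sum_{\eta\in\mathcal{G}}\eta p^\eta_t}$ (here $\hat c_t=w_t$), observes the subgradient $g_t=\hat x_t-x_t\in\partial\ell_t(\hat c_t)$, and sets $p^\eta_{t+1}=p^\eta_t e^{-f^\eta_t(w^\eta_t)}/Z_t$ with $Z_t=\sum_{\eta\in\mathcal{G}}p^\eta_te^{-f^\eta_t(w^\eta_t)}$. ONS with parameter $\gamma$ on losses $q_t$: $\varepsilon=\frac{n}{W^2\gamma^2}$, $A_0=\varepsilon I_n$, any $w_1\in\mathcal{W}$; $A_t=A_{t-1}+\nabla q_t(w_t)\nabla q_t(w_t)^\top$, $w_{t+1}=\arg\min_{w\in\mathcal{W}}\|w_t-\frac1\gamma A_t^{-1}\nabla q_t(w_t)-w\|_{A_t}^2$ with $\|y\|_A=\sqrt{y^\top Ay}$.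 For the $\eta$-expert, $q_t=f^\eta_t$ and $\gamma=\frac{1}{(1+2\eta H)^2}$.
   Formalization: The logarithm ln(DKT/(Bn)) is replaced by ln(max(e, DKT/(Bn))), since the bound as written fails when DKT/(Bn) is at or below 1 (e.g. n=T=1, B=DK gives right side 0 but positive regret); for DKT/(Bn) ≥ e the two agree. *)

theory Defs
  imports "HOL-Analysis.Analysis"
begin

text \<open>Euclidean space R^n is represented by functions nat => real vanishing
  outside the index set {..<n}; the dimension n is thus an ordinary value, so that
  the constant in the final bound can be stated independently of n.  Topological
  notions (closed, compact) are the library ones for the product topology on
  nat => real, which agrees with the Euclidean topology on this subspace.\<close>

definition Rn :: "nat \<Rightarrow> (nat \<Rightarrow> real) set" where
  "Rn n = {v. \<forall>i\<ge>n. v i = 0}"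

definition ip :: "nat \<Rightarrow> (nat \<Rightarrow> real) \<Rightarrow> (nat \<Rightarrow> real) \<Rightarrow> real" where
  "ip n x y = (\<Sum>i<n. x i * y i)"

definition l2dist :: "nat \<Rightarrow> (nat \<Rightarrow> real) \<Rightarrow> (nat \<Rightarrow> real) \<Rightarrow> real" where
  "l2dist n x y = sqrt (\<Sum>i<n. (x i - y i)^2)"

definition vsub :: "(nat \<Rightarrow> real) \<Rightarrow> (nat \<Rightarrow> real) \<Rightarrow> (nat \<Rightarrow> real)" where
  "vsub x y = (\<lambda>i. x i - y i)"

definition vadd :: "(nat \<Rightarrow> real) \<Rightarrow> (nat \<Rightarrow> real) \<Rightarrow> (nat \<Rightarrow> real)" where
  "vadd x y = (\<lambda>i. x i + y i)"

definition vscale :: "real \<Rightarrow> (nat \<Rightarrow> real) \<Rightarrow> (nat \<Rightarrow> real)" where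
  "vscale a x = (\<lambda>i. a * x i)"

definition convex_n :: "(nat \<Rightarrow> real) set \<Rightarrow> bool" where
  "convex_n S \<longleftrightarrow> (\<forall>x\<in>S. \<forall>y\<in>S. \<forall>u::real. 0 \<le> u \<and> u \<le> 1 \<longrightarrow>
       (\<lambda>i. (1 - u) * x i + u * y i) \<in> S)"

text \<open>n x n matrices as nat => nat => real (entries with indices < n matter).\<close>
definition mv :: "nat \<Rightarrow> (nat \<Rightarrow> nat \<Rightarrow> real) \<Rightarrow> (nat \<Rightarrow> real) \<Rightarrow> (nat \<Rightarrow> real)" where
  "mv n M v = (\<lambda>i. if i < n then (\<Sum>j<n. M i j * v j) else 0)"

definition idmat :: "nat \<Rightarrow> (nat \<Rightarrow> nat \<Rightarrow> real)" where
  "idmat n = (\<lambda>i j. if i = j \<and> i < n then 1 else 0)"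

definition madd :: "(nat \<Rightarrow> nat \<Rightarrow> real) \<Rightarrow> (nat \<Rightarrow> nat \<Rightarrow> real) \<Rightarrow> (nat \<Rightarrow> nat \<Rightarrow> real)" where
  "madd M N = (\<lambda>i j. M i j + N i j)"

definition mscale :: "real \<Rightarrow> (nat \<Rightarrow> nat \<Rightarrow> real) \<Rightarrow> (nat \<Rightarrow> nat \<Rightarrow> real)" where
  "mscale a M = (\<lambda>i j. a * M i j)"

definition outer :: "(nat \<Rightarrow> real) \<Rightarrow> (nat \<Rightarrow> nat \<Rightarrow> real)" where
  "outer v = (\<lambda>i j. v i * v j)"

definition minv :: "nat \<Rightarrow> (nat \<Rightarrow> nat \<Rightarrow> real) \<Rightarrow> (nat \<Rightarrow> nat \<Rightarrow> real)" where
  "minv n M = (SOME N. (\<forall>i j. (i \<ge> n \<or> j \<ge> n) \<longrightarrow> N i j = 0) \<and>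
      (\<forall>i<n. \<forall>j<n. (\<Sum>k<n. M i k * N k j) = (if i = j then 1 else 0)))"

definition sqnorm_A :: "nat \<Rightarrow> (nat \<Rightarrow> nat \<Rightarrow> real) \<Rightarrow> (nat \<Rightarrow> real) \<Rightarrow> real" where
  "sqnorm_A n M y = ip n y (mv n M y)"

definition subopt_loss :: "nat \<Rightarrow> (nat \<Rightarrow> real) set \<Rightarrow> (nat \<Rightarrow> real) \<Rightarrow> (nat \<Rightarrow> real) \<Rightarrow> real" where
  "subopt_loss n X xt c = Sup ((\<lambda>x. ip n c x) ` X) - ip n c xt"

text \<open>MetaGrad parameters: number of grid points minus one, learning rates, prior.\<close>
definition mg_k :: "nat \<Rightarrow> nat" where
  "mg_k T = nat \<lceil>log 2 (real T) / 2\<rceil>"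

definition mg_eta :: "real \<Rightarrow> nat \<Rightarrow> real" where
  "mg_eta H i = (1 / 2 ^ i) / (5 * H)"

definition mg_prior :: "nat \<Rightarrow> nat \<Rightarrow> real" where
  "mg_prior T i = (1 + 1 / (1 + real (mg_k T))) / (real (i + 1) * real (i + 2))"

definition ons_gamma :: "real \<Rightarrow> real \<Rightarrow> real" where
  "ons_gamma H eta = 1 / (1 + 2 * eta * H)^2"

definition ons_eps :: "nat \<Rightarrow> real \<Rightarrow> real \<Rightarrow> real" where
  "ons_eps n W gamma = real n / (W^2 * gamma^2)"

text \<open>A run of MetaGrad (with ONS eta-experts, W = D, H = B) on the suboptimality
  losses, with argmax responses xhat.  Expert i (i = 0..k) has learning rate
  mg_eta B i; w i t is its iterate, A i t its ONS matrix, p i t its weight.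
  All choices left open by the algorithm (initial expert points, tie-breaking in
  argmax / argmin) are arbitrary: the predicate only states the defining relations.\<close>
definition metagrad_run ::
  "nat \<Rightarrow> nat \<Rightarrow> (nat \<Rightarrow> real) set \<Rightarrow> real \<Rightarrow> real \<Rightarrow>
   (nat \<Rightarrow> (nat \<Rightarrow> real) set) \<Rightarrow> (nat \<Rightarrow> (nat \<Rightarrow> real)) \<Rightarrow>
   (nat \<Rightarrow> (nat \<Rightarrow> real)) \<Rightarrow> (nat \<Rightarrow> (nat \<Rightarrow> real)) \<Rightarrow>
   (nat \<Rightarrow> nat \<Rightarrow> (nat \<Rightarrow> real)) \<Rightarrow> (nat \<Rightarrow> nat \<Rightarrow> (nat \<Rightarrow> nat \<Rightarrow> real)) \<Rightarrow>
   (nat \<Rightarrow> nat \<Rightarrow> real) \<Rightarrow> bool" where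
  "metagrad_run n T \<Theta> D B X xs chat xhat w A p \<longleftrightarrow>
    (let k = mg_k T;
         eta = mg_eta B;
         gam = (\<lambda>i. ons_gamma B (eta i));
         g = (\<lambda>t. vsub (xhat t) (xs t));
         grad = (\<lambda>i t. vadd (vscale (eta i) (g t))
                   (vscale (2 * (eta i)^2 * ip n (vsub (w i t) (chat t)) (g t)) (g t)));
         f = (\<lambda>i t. - eta i * ip n (vsub (chat t) (w i t)) (g t)
                   + (eta i)^2 * (ip n (vsub (chat t) (w i t)) (g t))^2)
     in
     \<comment> \<open>initialisation\<close>
     (\<forall>i\<le>k. w i 1 \<in> \<Theta>) \<and>
     (\<forall>i\<le>k. A i 0 = mscale (ons_eps n D (gam i)) (idmat n)) \<and>
     (\<forall>i\<le>k. p i 1 = mg_prior T i) \<and>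
     (\<forall>t\<in>{1..T}.
        \<comment> \<open>MetaGrad's play\<close>
        chat t = vscale (1 / (\<Sum>i\<le>k. eta i * p i t))
                    (\<lambda>j. \<Sum>i\<le>k. eta i * p i t * w i t j) \<and>
        \<comment> \<open>agent's response: argmax\<close>
        xhat t \<in> X t \<and> (\<forall>x\<in>X t. ip n (chat t) x \<le> ip n (chat t) (xhat t)) \<and>
        \<comment> \<open>ONS updates of the eta-experts\<close>
        (\<forall>i\<le>k.
           A i t = madd (A i (t - 1)) (outer (grad i t)) \<and>
           (let y = vsub (w i t) (vscale (1 / gam i) (mv n (minv n (A i t)) (grad i t)))
            in w i (Suc t) \<in> \<Theta> \<and>
               (\<forall>v\<in>\<Theta>. sqnorm_A n (A i t) (vsub y (w i (Suc t)))
                          \<le> sqnorm_A n (A i t) (vsub y v)))) \<and>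
        \<comment> \<open>exponential weights update\<close>
        (\<forall>i\<le>k. p i (Suc t) = p i t * exp (- f i t) /
                  (\<Sum>j\<le>k. p j t * exp (- f j t)))))"

end

theory Submission
  imports Defs
begin

text \<open>Let \<open>r t = ip (chat t - cstar) (xhat t - xs t)\<close>.  Exponential weights on the tilted surrogate losses
  and the ONS regret bound give, for every learning rate \<open>\<eta>\<close> of the grid,
  \<open>\<eta> * (\<Sum>t. r t) - \<eta>\<^sup>2 * (\<Sum>t. (r t)\<^sup>2) \<le> ln (1 / prior) + O(n * L)\<close>.
  Since \<open>- r t\<close> is at most the suboptimality loss of \<open>cstar\<close> and \<open>\<bar>r t\<bar> \<le> B\<close>, the quadratic term is
  self-bounding: \<open>(\<Sum>t. (r t)\<^sup>2) \<le> B * (\<Sum>t. r t) + 2 * B * Delta\<close>.  Choosing the learning rate nearest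
  to \<open>sqrt (n * L / (B * Delta))\<close> gives the bound.\<close>

section \<open>Regularised Gram forms\<close>

text \<open>The usual analysis of the Online Newton Step rests on log-determinants. Here the
  matrices of the experts are seen only through the bilinear forms that they induce, and the
  quantity "g transposed times inverse of A times g" becomes the value of \<open>ip n g\<close> at a
  solution of a linear equation, so that it can be bounded by induction on the dimension. All
  additive constants are absorbed into \<open>L\<close>, which is at least 1. Comparing the
  logarithms of an expert with \<open>L\<close> uses \<open>n <= T\<close>; for \<open>n > T\<close>
  the trivial bound \<open>T * B\<close> on the regret is already small enough.\<close>

lemma ip_lincomb_left: "ip n (\<lambda>i. a * u i + b * v i) w = a * ip n u w + b * ip n v w"
  by (simp add: ip_def sum.distrib sum_distrib_left algebra_simps)

lemma ip_commute: "ip n u v = ip n v u"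
  by (simp add: ip_def mult.commute)

lemma ip_lincomb_right: "ip n w (\<lambda>i. a * u i + b * v i) = a * ip n w u + b * ip n w v"
  using ip_lincomb_left[of n a u b v w] by (simp add: ip_commute)

lemma ip_vsub_left: "ip n (vsub u v) w = ip n u w - ip n v w"
  by (simp add: ip_def vsub_def sum_subtractf left_diff_distrib)

lemma ip_vsub_right: "ip n w (vsub u v) = ip n w u - ip n w v"
  by (simp add: ip_def vsub_def sum_subtractf right_diff_distrib)

lemma ip_vscale_left: "ip n (vscale a u) w = a * ip n u w"
  by (simp add: ip_def vscale_def sum_distrib_left mult.assoc)

lemma ip_self_nonneg: "ip n u u \<ge> 0"
  by (simp add: ip_def sum_nonneg)

lemma ip_eq_l2dist: "ip n (vsub x y) (vsub x y) = (l2dist n x y)\<^sup>2"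
  by (simp add: ip_def vsub_def l2dist_def sum_nonneg power2_eq_square[symmetric])

lemma ip_Cauchy_Schwarz: "(ip n u v)\<^sup>2 \<le> ip n u u * ip n v v"
proof -
  have "\<bar>ip n u v\<bar> \<le> L2_set u {..<n} * L2_set v {..<n}"
    unfolding ip_def
    by (rule order_trans[OF sum_abs]) (simp add: abs_mult L2_set_mult_ineq)
  then have "(ip n u v)\<^sup>2 \<le> (L2_set u {..<n} * L2_set v {..<n})\<^sup>2"
    using power_mono[of "\<bar>ip n u v\<bar>" "L2_set u {..<n} * L2_set v {..<n}" 2] by simp
  also have "\<dots> = ip n u u * ip n v v"
    by (simp add: ip_def L2_set_def power_mult_distrib sum_nonneg power2_eq_square[symmetric])
  finally show ?thesis .
qed

text \<open>The form of the matrix "e times identity plus the sum of the outer products of g 1, ...,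
  g t", which is the ONS matrix of round \<open>t\<close>.\<close>

definition gram :: "nat \<Rightarrow> real \<Rightarrow> (nat \<Rightarrow> nat \<Rightarrow> real) \<Rightarrow> nat \<Rightarrow> (nat \<Rightarrow> real) \<Rightarrow> (nat \<Rightarrow> real) \<Rightarrow> real"
  where "gram n e g t u v = e * ip n u v + (\<Sum>s=1..t. ip n (g s) u * ip n (g s) v)"

lemma gram_0: "gram n e g 0 u v = e * ip n u v"
  by (simp add: gram_def)

lemma gram_Suc: "gram n e g (Suc t) u v = gram n e g t u v + ip n (g (Suc t)) u * ip n (g (Suc t)) v"
  by (simp add: gram_def)

lemma gram_commute: "gram n e g t u v = gram n e g t v u"
  by (simp add: gram_def ip_commute mult.commute)

lemma gram_lincomb_left:
  "gram n e g t (\<lambda>i. a * u i + b * v i) w = a * gram n e g t u w + b * gram n e g t v w"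
  by (simp add: gram_def ip_lincomb_left ip_lincomb_right sum.distrib sum_distrib_left algebra_simps)

lemma gram_lincomb_right:
  "gram n e g t w (\<lambda>i. a * u i + b * v i) = a * gram n e g t w u + b * gram n e g t w v"
  using gram_lincomb_left[of n e g t a u b v w] by (simp add: gram_commute)

lemma gram_self_ge: "gram n e g t u u \<ge> e * ip n u u"
  by (simp add: gram_def sum_nonneg)

lemma gram_self_nonneg: "e \<ge> 0 \<Longrightarrow> gram n e g t u u \<ge> 0"
  by (meson gram_self_ge ip_self_nonneg mult_nonneg_nonneg order_trans)

text \<open>The induction step is the Sherman--Morrison formula.\<close>

lemma gram_solvable:
  assumes "e > 0"
  shows "\<exists>x. \<forall>v. gram n e g t x v = ip n h v"
proof (induction t arbitrary: h)
  case 0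
  show ?case
    using assms by (intro exI[of _ "vscale (1 / e) h"]) (simp add: gram_0 ip_vscale_left)
next
  case (Suc t)
  let ?g = "g (Suc t)"
  obtain a c where a: "\<And>v. gram n e g t a v = ip n h v" and c: "\<And>v. gram n e g t c v = ip n ?g v"
    using Suc.IH by metis
  have "ip n ?g c \<ge> 0"
    using c[of c] gram_self_nonneg[of e n g t c] assms by simp
  then have nz: "1 + ip n ?g c \<noteq> 0" by simp
  define \<kappa> where "\<kappa> = ip n ?g a / (1 + ip n ?g c)"
  have \<kappa>: "ip n ?g a - \<kappa> * ip n ?g c = \<kappa>"
    using nz by (simp add: \<kappa>_def field_simps)
  have "gram n e g (Suc t) (\<lambda>i. 1 * a i + (- \<kappa>) * c i) v = ip n h v" for v
  proof -
    have "gram n e g (Suc t) (\<lambda>i. 1 * a i + (- \<kappa>) * c i) v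
        = ip n h v + (- \<kappa>) * ip n ?g v + (ip n ?g a - \<kappa> * ip n ?g c) * ip n ?g v"
      unfolding gram_Suc gram_lincomb_left ip_lincomb_right a c by (simp add: algebra_simps)
    then show ?thesis by (simp add: \<kappa>)
  qed
  then show ?case by blast
qed

text \<open>Test each equation with the other solution and use symmetry. Only the value is unique:
  the solutions may differ in coordinates from \<open>n\<close> on, which the form ignores.\<close>

lemma gram_solution_value_unique:
  assumes "\<And>v. gram n e g t x v = ip n h v" "\<And>v. gram n e g t y v = ip n h v"
  shows "ip n h x = ip n h y"
  by (metis assms gram_commute)

text \<open>This is \<open>ln z <= z - 1\<close> at \<open>z = a / b\<close>; it turns the growth of
  a potential into a difference of logarithms that telescopes.\<close>

lemma one_minus_inverse_le_ln_ratio: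
  fixes a b c :: real
  assumes "0 < a" "0 < b" "c \<le> b - a"
  shows "c / b \<le> ln b - ln a"
proof -
  have "ln (a / b) \<le> a / b - 1" using assms by (intro ln_le_minus_one) simp
  moreover have "c / b \<le> 1 - a / b" using assms by (simp add: field_simps)
  ultimately show ?thesis using assms by (simp add: ln_div)
qed

text \<open>Elimination of the last coordinate: \<open>E t\<close> is the \<open>gram\<close>-orthogonal complement of the first
  \<open>n\<close> coordinates, normalised to have last coordinate 1, and \<open>d t\<close> is the Schur complement.  The
  latter plays the role of a ratio of determinants, so the sum telescopes without determinants.\<close>

lemma gram_potential:
  assumes e: "e > 0"
    and "\<And>t v. t \<in> {1..T} \<Longrightarrow> gram n e g t (x t) v = ip n (g t) v"
  shows "(\<Sum>t=1..T. ip n (g t) (x t)) \<le> (\<Sum>i<n. ln (1 + (\<Sum>t=1..T. (g t i)\<^sup>2) / e))"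
  using assms(2)
proof (induction n arbitrary: x)
  case 0
  then show ?case by (simp add: ip_def)
next
  case (Suc n)
  \<comment> \<open>Block form in dimension \<open>Suc n\<close>: \<open>bb t\<close> is the
    off-diagonal column of the matrix, and \<open>\<beta> t\<close> below solves the leading block
    against it.\<close>
  define bb where "bb t = (\<lambda>i. \<Sum>s=1..t. g s n * g s i)" for t
  have ip_bb: "ip n (bb t) v = (\<Sum>s=1..t. g s n * ip n (g s) v)" for t v
    unfolding ip_def bb_def sum_distrib_right sum_distrib_left
    by (subst sum.swap) (simp add: mult.assoc)
  have "\<forall>t. \<exists>\<beta>. \<forall>v. gram n e g t \<beta> v = ip n (bb t) v"
    using gram_solvable[OF e] by blast
  then obtain \<beta> where \<beta>: "\<And>t v. gram n e g t (\<beta> t) v = ip n (bb t) v" by metis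
  have "\<forall>t. \<exists>y. \<forall>v. gram n e g t y v = ip n (g t) v"
    using gram_solvable[OF e] by blast
  then obtain y where y: "\<And>t v. gram n e g t (y t) v = ip n (g t) v" by metis
  have ipS: "ip (Suc n) u v = ip n u v + u n * v n" for u v by (simp add: ip_def)
  have ip_cong: "ip n u v = ip n u v'" if "\<And>i. i < n \<Longrightarrow> v i = v' i" for u v v'
    using that by (simp add: ip_def)
  have gram_cong: "gram n e g t u v = gram n e g t u' v'"
    if "\<And>i. i < n \<Longrightarrow> u i = u' i" "\<And>i. i < n \<Longrightarrow> v i = v' i" for t u v u' v'
    using that by (simp add: gram_def ip_def)
  have gramS: "gram (Suc n) e g t u v = gram n e g t u v + u n * ip n (bb t) v + v n * ip n (bb t) u
      + u n * v n * (e + (\<Sum>s=1..t. (g s n)\<^sup>2))" for t u v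
    unfolding gram_def ipS ip_bb
    by (simp add: sum.distrib sum_distrib_left algebra_simps power2_eq_square)
  define E where "E t = (\<lambda>i. if i < n then - \<beta> t i else 1)" for t
  define d where "d t = gram (Suc n) e g t (E t) (E t)" for t
  have E_n: "E t n = 1" for t by (simp add: E_def)
  have gE: "gram n e g t (E t) v = - ip n (bb t) v" for t v
  proof -
    have "gram n e g t (E t) v = gram n e g t (\<lambda>i. (-1) * \<beta> t i + 0 * \<beta> t i) v"
      by (rule gram_cong) (auto simp: E_def)
    then show ?thesis unfolding gram_lincomb_left \<beta> by simp
  qed
  have E_orth: "gram (Suc n) e g t (E t) v = d t * v n" for t v
  proof -
    have "gram (Suc n) e g t (E t) v = v n * (ip n (bb t) (E t) + (e + (\<Sum>s=1..t. (g s n)\<^sup>2)))" for v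
      by (simp add: gramS gE E_n algebra_simps)
    then show ?thesis by (simp add: d_def E_n)
  qed
  have d_ge: "d t \<ge> e" for t
  proof -
    have "e * 1 \<le> e * ip (Suc n) (E t) (E t)"
      using e ip_self_nonneg[of n "E t"] by (intro mult_left_mono) (auto simp: ipS E_n)
    then show ?thesis using gram_self_ge[of e "Suc n" "E t" g t] by (simp add: d_def)
  qed
  then have d_pos: "d t > 0" for t using e by (meson less_le_trans)
  \<comment> \<open>Variational form of the Schur complement, from expanding the nonnegative form at
    \<open>v - E t\<close>. It allows vectors of other rounds to serve as competitors.\<close>
  have d_min: "d t \<le> gram (Suc n) e g t v v" if "v n = 1" for t v
  proof -
    have "0 \<le> gram (Suc n) e g t (\<lambda>i. 1 * v i + (-1) * E t i) (\<lambda>i. 1 * v i + (-1) * E t i)"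
      using e by (intro gram_self_nonneg) simp
    also have "\<dots> = gram (Suc n) e g t v v - d t"
      unfolding gram_lincomb_left gram_lincomb_right E_orth gram_commute[of _ _ _ _ v "E t"]
      using that by (simp add: E_n)
    finally show ?thesis by simp
  qed
  \<comment> \<open>\<open>E t\<close> competes in round \<open>t - 1\<close>; there its form lacks
    exactly the rank-one term contributed by \<open>g t\<close>.\<close>
  have d_step: "(ip (Suc n) (g t) (E t))\<^sup>2 / d t \<le> ln (d t) - ln (d (t - 1))" if t: "t \<in> {1..T}" for t
  proof -
    obtain s where s: "t = Suc s" using t by (cases t) auto
    have "d s \<le> gram (Suc n) e g s (E t) (E t)" by (rule d_min) (rule E_n)
    also have "\<dots> = d t - (ip (Suc n) (g t) (E t))\<^sup>2"
      by (simp add: d_def s gram_Suc power2_eq_square)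
    finally show ?thesis using d_pos s by (intro one_minus_inverse_le_ln_ratio) auto
  qed
  \<comment> \<open>The solution splits orthogonally into the solution for dimension
    \<open>n\<close>, padded by 0, and a multiple \<open>c\<close> of \<open>E t\<close>.\<close>
  have val: "ip (Suc n) (g t) (x t) = ip n (g t) (y t) + (ip (Suc n) (g t) (E t))\<^sup>2 / d t"
    if t: "t \<in> {1..T}" for t
  proof -
    define Y where "Y = (\<lambda>i. if i < n then y t i else 0)"
    define c where "c = ip (Suc n) (g t) (E t) / d t"
    have Y_n: "Y n = 0" by (simp add: Y_def)
    have gY: "gram (Suc n) e g t Y v = ip (Suc n) (g t) v - v n * ip (Suc n) (g t) (E t)" for v
    proof -
      \<comment> \<open>\<open>Y\<close> is orthogonal to \<open>E t\<close>, so subtracting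
        \<open>v n\<close> times \<open>E t\<close> changes nothing and makes the last coordinate of
        the argument 0.\<close>
      have "gram (Suc n) e g t Y v = gram (Suc n) e g t Y (\<lambda>i. 1 * v i + (- v n) * E t i)"
        unfolding gram_lincomb_right using E_orth[of t Y]
        by (simp add: gram_commute[of _ _ _ _ Y "E t"] Y_n)
      also have "\<dots> = gram n e g t Y (\<lambda>i. 1 * v i + (- v n) * E t i)"
        by (simp add: gramS Y_n E_n)
      also have "\<dots> = gram n e g t (y t) (\<lambda>i. 1 * v i + (- v n) * E t i)"
        by (rule gram_cong) (auto simp: Y_def)
      also have "\<dots> = ip (Suc n) (g t) (\<lambda>i. 1 * v i + (- v n) * E t i)"
        by (simp add: y ipS E_n)
      finally show ?thesis unfolding ip_lincomb_right by simp
    qed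
    have "gram (Suc n) e g t (\<lambda>i. 1 * Y i + c * E t i) v = ip (Suc n) (g t) v" for v
      unfolding gram_lincomb_left gY E_orth using d_pos[of t] by (simp add: c_def)
    then have "ip (Suc n) (g t) (x t) = ip (Suc n) (g t) (\<lambda>i. 1 * Y i + c * E t i)"
      using Suc.prems[OF t] by (intro gram_solution_value_unique)
    also have "\<dots> = ip n (g t) Y + c * ip (Suc n) (g t) (E t)"
      unfolding ip_lincomb_right by (simp add: ipS[of _ Y] Y_n)
    also have "ip n (g t) Y = ip n (g t) (y t)"
      by (rule ip_cong) (simp add: Y_def)
    finally show ?thesis by (simp add: c_def power2_eq_square)
  qed
  have "(\<Sum>t=1..T. (ip (Suc n) (g t) (E t))\<^sup>2 / d t) \<le> (\<Sum>t=1..T. ln (d t) - ln (d (t - 1)))"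
    by (rule sum_mono) (rule d_step)
  also have "\<dots> = ln (d T) - ln (d 0)"
    by (induction T) auto
  also have "\<dots> \<le> ln (e + (\<Sum>t=1..T. (g t n)\<^sup>2)) - ln e"
  proof -
    \<comment> \<open>With the last unit vector as competitor, the Schur complement is at most the
      diagonal entry.\<close>
    have "d T \<le> gram (Suc n) e g T (\<lambda>i. if i = n then 1 else 0) (\<lambda>i. if i = n then 1 else 0)"
      by (rule d_min) simp
    also have "\<dots> = e + (\<Sum>t=1..T. (g t n)\<^sup>2)"
      unfolding gramS by (simp add: gram_def ip_def)
    finally have "ln (d T) \<le> ln (e + (\<Sum>t=1..T. (g t n)\<^sup>2))"
      using d_pos by (simp add: ln_mono)
    moreover have "ln e \<le> ln (d 0)" using d_ge e by (simp add: ln_mono)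
    ultimately show ?thesis by simp
  qed
  also have "\<dots> = ln (1 + (\<Sum>t=1..T. (g t n)\<^sup>2) / e)"
  proof -
    have "e + (\<Sum>t=1..T. (g t n)\<^sup>2) > 0" using e by (simp add: add_pos_nonneg sum_nonneg)
    moreover have "1 + (\<Sum>t=1..T. (g t n)\<^sup>2) / e = (e + (\<Sum>t=1..T. (g t n)\<^sup>2)) / e"
      using e by (simp add: field_simps)
    ultimately show ?thesis using e by (simp add: ln_div)
  qed
  finally have "(\<Sum>t=1..T. (ip (Suc n) (g t) (E t))\<^sup>2 / d t) \<le> ln (1 + (\<Sum>t=1..T. (g t n)\<^sup>2) / e)" .
  moreover have "(\<Sum>t=1..T. ip n (g t) (y t)) \<le> (\<Sum>i<n. ln (1 + (\<Sum>t=1..T. (g t i)\<^sup>2) / e))"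
    by (rule Suc.IH) (rule y)
  ultimately show ?case by (simp add: val sum.distrib)
qed

section \<open>Online Newton Step\<close>

lemma ip_mv_madd: "ip n u (mv n (madd M N) v) = ip n u (mv n M v) + ip n u (mv n N v)"
  by (simp add: ip_def mv_def madd_def distrib_right distrib_left sum.distrib)

lemma ip_mv_outer: "ip n u (mv n (outer g) v) = ip n g u * ip n g v"
  unfolding ip_def mv_def outer_def sum_product
  by (simp add: sum_distrib_left) (simp add: mult_ac)

lemma ip_mv_scaled_idmat: "ip n u (mv n (mscale e (idmat n)) v) = e * ip n u v"
proof -
  have "(\<Sum>j<n. mscale e (idmat n) i j * v j) = e * v i" if "i < n" for i
  proof -
    have "(\<Sum>j<n. mscale e (idmat n) i j * v j) = (\<Sum>j<n. if j = i then e * v i else 0)"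
      using that by (intro sum.cong) (auto simp: mscale_def idmat_def)
    then show ?thesis using that by simp
  qed
  then show ?thesis
    by (simp add: ip_def mv_def sum_distrib_left algebra_simps)
qed

lemma ip_mv_eq_gram:
  assumes "A 0 = mscale e (idmat n)"
    and "\<And>t. t \<in> {1..T} \<Longrightarrow> A t = madd (A (t - 1)) (outer (g t))"
    and "t \<le> T"
  shows "ip n u (mv n (A t) v) = gram n e g t u v"
  using assms(3)
proof (induction t)
  case 0
  then show ?case by (simp add: assms(1) ip_mv_scaled_idmat gram_0)
next
  case (Suc t)
  then have "A (Suc t) = madd (A t) (outer (g (Suc t)))"
    using assms(2)[of "Suc t"] by simp
  then show ?case using Suc by (simp add: ip_mv_madd ip_mv_outer gram_Suc)
qed

lemma ip_unit_left: "i < n \<Longrightarrow> ip n (\<lambda>k. if k = i then 1 else 0) v = v i"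
  by (simp add: ip_def if_distrib[of "\<lambda>x. x * _"] cong: if_cong)

text \<open>\<open>minv\<close> is a choice, so some right inverse has to be exhibited first: its
  columns solve the equations for the unit vectors. After that only the defining property of a right
  inverse is available, and it suffices.\<close>

lemma minv_solves_gram:
  assumes e: "e > 0" and M: "\<And>u v. ip n u (mv n M v) = gram n e g t u v"
  shows "gram n e g t (mv n (minv n M) h) v = ip n h v"
proof -
  define unit where "unit j = (\<lambda>k. if k = j then 1 else 0 :: real)" for j :: nat
  have "\<forall>j. \<exists>x. \<forall>v. gram n e g t x v = ip n (unit j) v"
    using gram_solvable[OF e] by blast
  then obtain x where x: "\<And>j v. gram n e g t (x j) v = ip n (unit j) v" by metis
  define N where "N i j = (if i < n \<and> j < n then x j i else 0)" for i j
  have "(\<Sum>k<n. M i k * N k j) = (if i = j then 1 else 0)" if "i < n" "j < n" for i j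
  proof -
    have "(\<Sum>k<n. M i k * N k j) = mv n M (x j) i"
      using that by (simp add: mv_def N_def)
    also have "\<dots> = gram n e g t (unit i) (x j)"
      using that by (simp add: M[symmetric] unit_def ip_unit_left)
    also have "\<dots> = unit i j"
      using that(2) x[of j "unit i"] by (simp add: gram_commute ip_unit_left unit_def)
    finally show ?thesis by (auto simp: unit_def)
  qed
  then have "\<exists>N. (\<forall>i j. (i \<ge> n \<or> j \<ge> n) \<longrightarrow> N i j = 0) \<and>
      (\<forall>i<n. \<forall>j<n. (\<Sum>k<n. M i k * N k j) = (if i = j then 1 else 0))"
    by (intro exI[of _ N]) (auto simp: N_def)
  from someI_ex[OF this] have inv:
    "(\<Sum>k<n. M i k * minv n M k j) = (if i = j then 1 else 0)" if "i < n" "j < n" for i j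
    using that unfolding minv_def by blast
  have "mv n M (mv n (minv n M) h) i = h i" if "i < n" for i
  proof -
    have "mv n M (mv n (minv n M) h) i = (\<Sum>k<n. \<Sum>j<n. M i k * minv n M k j * h j)"
      using that by (simp add: mv_def sum_distrib_left mult.assoc)
    also have "\<dots> = (\<Sum>j<n. (\<Sum>k<n. M i k * minv n M k j) * h j)"
      by (subst sum.swap) (simp add: sum_distrib_right)
    also have "\<dots> = (\<Sum>j<n. if j = i then h j else 0)"
      using that by (intro sum.cong) (auto simp: inv)
    finally show ?thesis using that by simp
  qed
  then have "ip n v (mv n M (mv n (minv n M) h)) = ip n v h"
    by (simp add: ip_def)
  then show ?thesis
    by (simp add: M gram_commute ip_commute)
qed

text \<open>First-order optimality: moving from \<open>z\<close> a fraction \<open>l\<close> towards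
  \<open>u\<close> stays in \<open>S\<close>, and a positive linear gain in \<open>l\<close> would
  beat the quadratic cost.\<close>

lemma projection_obtuse:
  assumes e: "e \<ge> 0" and conv: "convex_n S" and u: "u \<in> S" and z: "z \<in> S"
    and min: "\<And>v. v \<in> S \<Longrightarrow>
      gram n e g t (vsub y z) (vsub y z) \<le> gram n e g t (vsub y v) (vsub y v)"
  shows "gram n e g t (vsub y z) (vsub u z) \<le> 0"
proof (rule ccontr)
  let ?ab = "gram n e g t (vsub y z) (vsub u z)" and ?bb = "gram n e g t (vsub u z) (vsub u z)"
  assume "\<not> ?ab \<le> 0"
  then have pos: "?ab > 0" by simp
  have bb: "?bb \<ge> 0" using e by (rule gram_self_nonneg)
  \<comment> \<open>Small enough that \<open>l * ?bb <= ?ab\<close>, against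
    \<open>2 * ?ab <= l * ?bb\<close>; the summand 1 guards against a zero denominator.\<close>
  define l where "l = min 1 (?ab / (?bb + 1))"
  have l: "0 < l" "l \<le> 1" using pos bb by (auto simp: l_def)
  have "(\<lambda>i. (1 - l) * z i + l * u i) \<in> S"
    using conv z u l unfolding convex_n_def by auto
  from min[OF this] have "gram n e g t (vsub y z) (vsub y z)
      \<le> gram n e g t (\<lambda>i. 1 * vsub y z i + (- l) * vsub u z i) (\<lambda>i. 1 * vsub y z i + (- l) * vsub u z i)"
    by (simp add: vsub_def algebra_simps)
  also have "\<dots> = gram n e g t (vsub y z) (vsub y z) - 2 * l * ?ab + l * (l * ?bb)"
    unfolding gram_lincomb_left gram_lincomb_right gram_commute[of _ _ _ _ "vsub u z" "vsub y z"]
    by (simp add: algebra_simps)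
  finally have "l * (2 * ?ab) \<le> l * (l * ?bb)" by simp
  then have "2 * ?ab \<le> l * ?bb" using l by simp
  also have "\<dots> \<le> ?ab / (?bb + 1) * ?bb" using bb by (intro mult_right_mono) (auto simp: l_def)
  also have "\<dots> \<le> ?ab" using pos bb by (simp add: field_simps)
  finally show False using pos by simp
qed

text \<open>Expand the square of \<open>y - u\<close> around \<open>z\<close>; the cross term has
  the right sign by \<open>projection_obtuse\<close>.\<close>

lemma projection_nonexpansive:
  assumes e: "e \<ge> 0" and "convex_n S" "u \<in> S" "z \<in> S"
    and "\<And>v. v \<in> S \<Longrightarrow>
      gram n e g t (vsub y z) (vsub y z) \<le> gram n e g t (vsub y v) (vsub y v)"
  shows "gram n e g t (vsub z u) (vsub z u) \<le> gram n e g t (vsub y u) (vsub y u)"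
proof -
  have eq: "vsub y u = (\<lambda>i. 1 * vsub y z i + (-1) * vsub u z i)"
    "vsub z u = (\<lambda>i. (-1) * vsub u z i + 0 * vsub u z i)"
    by (auto simp: vsub_def)
  have "gram n e g t (vsub z u) (vsub z u) = gram n e g t (vsub u z) (vsub u z)"
    unfolding eq(2) gram_lincomb_left gram_lincomb_right by simp
  moreover have "gram n e g t (vsub y u) (vsub y u) = gram n e g t (vsub y z) (vsub y z)
      - 2 * gram n e g t (vsub y z) (vsub u z) + gram n e g t (vsub u z) (vsub u z)"
    unfolding eq(1) gram_lincomb_left gram_lincomb_right
      gram_commute[of _ _ _ _ "vsub u z" "vsub y z"] by simp
  ultimately show ?thesis
    using projection_obtuse[OF assms] gram_self_nonneg[OF e, of n g t "vsub y z"] by linarith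
qed

text \<open>The potential is the squared distance to \<open>u\<close> in the current norm.
  Projecting does not increase it, and the change of norm from round \<open>t - 1\<close> to round
  \<open>t\<close> adds exactly the square that the left-hand side subtracts. The remaining cost of
  a round is what \<open>gram_potential\<close> sums up.\<close>

lemma ons_regret:
  assumes e: "e > 0" and \<gamma>: "\<gamma> > 0" and conv: "convex_n S" and u: "u \<in> S"
    and A0: "A 0 = mscale e (idmat n)"
    and AS: "\<And>t. t \<in> {1..T} \<Longrightarrow> A t = madd (A (t - 1)) (outer (g t))"
    and S: "\<And>t. t \<in> {1..T} \<Longrightarrow> w (Suc t) \<in> S"
    and proj: "\<And>t v. t \<in> {1..T} \<Longrightarrow> v \<in> S \<Longrightarrow>
      sqnorm_A n (A t) (vsub (vsub (w t) (vscale (1 / \<gamma>) (mv n (minv n (A t)) (g t)))) (w (Suc t)))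
      \<le> sqnorm_A n (A t) (vsub (vsub (w t) (vscale (1 / \<gamma>) (mv n (minv n (A t)) (g t)))) v)"
  shows "(\<Sum>t=1..T. ip n (g t) (vsub (w t) u) - \<gamma> / 2 * (ip n (g t) (vsub (w t) u))\<^sup>2)
    \<le> \<gamma> / 2 * e * (l2dist n (w 1) u)\<^sup>2
      + 1 / (2 * \<gamma>) * (\<Sum>i<n. ln (1 + (\<Sum>t=1..T. (g t i)\<^sup>2) / e))"
proof -
  define x where "x t = mv n (minv n (A t)) (g t)" for t
  \<comment> \<open>The norm of round \<open>t\<close> is paired with the iterate of round
    \<open>t + 1\<close>, so \<open>\<Phi> 0\<close> involves only \<open>w 1\<close> and the scaled
    identity.\<close>
  define \<Phi> where "\<Phi> t = gram n e g t (vsub (w (Suc t)) u) (vsub (w (Suc t)) u)" for t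
  have mat: "ip n a (mv n (A t) b) = gram n e g t a b" if "t \<le> T" for t a b
    using ip_mv_eq_gram[OF A0 AS that] .
  have x: "gram n e g t (x t) v = ip n (g t) v" if "t \<in> {1..T}" for t v
    unfolding x_def using that by (intro minv_solves_gram e mat) simp
  have step: "ip n (g t) (vsub (w t) u) - \<gamma> / 2 * (ip n (g t) (vsub (w t) u))\<^sup>2
      \<le> \<gamma> / 2 * (\<Phi> (t - 1) - \<Phi> t) + 1 / (2 * \<gamma>) * ip n (g t) (x t)"
    if t: "t \<in> {1..T}" for t
  proof -
    define y where "y = vsub (w t) (vscale (1 / \<gamma>) (x t))"
    let ?d = "vsub (w t) u"
    obtain s where s: "t = Suc s" using t by (cases t) auto
    have "\<Phi> t \<le> gram n e g t (vsub y u) (vsub y u)"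
      unfolding \<Phi>_def
    proof (rule projection_nonexpansive[OF _ conv u S[OF t]])
      show "gram n e g t (vsub y (w (Suc t))) (vsub y (w (Suc t)))
          \<le> gram n e g t (vsub y v) (vsub y v)" if "v \<in> S" for v
        using proj[OF t that] t by (simp add: sqnorm_A_def mat y_def x_def)
    qed (use e in simp)
    also have "vsub y u = (\<lambda>i. 1 * ?d i + (- (1 / \<gamma>)) * x t i)"
      by (auto simp: y_def vsub_def vscale_def)
    also have "gram n e g t (\<lambda>i. 1 * ?d i + (- (1 / \<gamma>)) * x t i) (\<lambda>i. 1 * ?d i + (- (1 / \<gamma>)) * x t i)
        = gram n e g t ?d ?d - 2 / \<gamma> * ip n (g t) ?d + 1 / \<gamma>\<^sup>2 * ip n (g t) (x t)"
      unfolding gram_lincomb_left gram_lincomb_right gram_commute[of _ _ _ _ ?d "x t"] x[OF t]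
      using \<gamma> by (simp add: power2_eq_square field_simps)
    also have "gram n e g t ?d ?d = \<Phi> s + (ip n (g t) ?d)\<^sup>2"
      by (simp add: \<Phi>_def s gram_Suc power2_eq_square)
    finally have "\<gamma> / 2 * \<Phi> t \<le> \<gamma> / 2 * (\<Phi> s + (ip n (g t) ?d)\<^sup>2 - 2 / \<gamma> * ip n (g t) ?d
        + 1 / \<gamma>\<^sup>2 * ip n (g t) (x t))"
      using \<gamma> by (intro mult_left_mono) auto
    also have "\<dots> = \<gamma> / 2 * \<Phi> s + \<gamma> / 2 * (ip n (g t) ?d)\<^sup>2 - ip n (g t) ?d
        + 1 / (2 * \<gamma>) * ip n (g t) (x t)"
      using \<gamma> by (simp add: field_simps power2_eq_square)
    finally show ?thesis by (simp add: s right_diff_distrib)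
  qed
  have "(\<Sum>t=1..T. ip n (g t) (vsub (w t) u) - \<gamma> / 2 * (ip n (g t) (vsub (w t) u))\<^sup>2)
      \<le> (\<Sum>t=1..T. \<gamma> / 2 * (\<Phi> (t - 1) - \<Phi> t) + 1 / (2 * \<gamma>) * ip n (g t) (x t))"
    by (rule sum_mono) (rule step)
  also have "\<dots> = \<gamma> / 2 * (\<Sum>t=1..T. \<Phi> (t - 1) - \<Phi> t) + 1 / (2 * \<gamma>) * (\<Sum>t=1..T. ip n (g t) (x t))"
    by (simp add: sum.distrib sum_distrib_left)
  also have "\<dots> \<le> \<gamma> / 2 * (e * (l2dist n (w 1) u)\<^sup>2)
      + 1 / (2 * \<gamma>) * (\<Sum>i<n. ln (1 + (\<Sum>t=1..T. (g t i)\<^sup>2) / e))"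
  proof (intro add_mono mult_left_mono)
    have "(\<Sum>t=1..T. \<Phi> (t - 1) - \<Phi> t) = \<Phi> 0 - \<Phi> T"
      by (induction T) auto
    also have "\<dots> \<le> e * (l2dist n (w 1) u)\<^sup>2"
      using gram_self_nonneg[of e n g T] e by (simp add: \<Phi>_def gram_0 ip_eq_l2dist)
    finally show "(\<Sum>t=1..T. \<Phi> (t - 1) - \<Phi> t) \<le> e * (l2dist n (w 1) u)\<^sup>2" .
    show "(\<Sum>t=1..T. ip n (g t) (x t)) \<le> (\<Sum>i<n. ln (1 + (\<Sum>t=1..T. (g t i)\<^sup>2) / e))"
      using e x by (rule gram_potential)
  qed (use \<gamma> in auto)
  finally show ?thesis by (simp add: mult.assoc)
qed

section \<open>Exponential weights and tuning\<close>

lemma convex_n_weighted_mean: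
  fixes k :: nat
  assumes "convex_n S" and "\<And>i. i \<le> k \<Longrightarrow> 0 < c i" and "\<And>i. i \<le> k \<Longrightarrow> x i \<in> S"
  shows "vscale (1 / (\<Sum>i\<le>k. c i)) (\<lambda>j. \<Sum>i\<le>k. c i * x i j) \<in> S"
  using assms(2,3)
proof (induction k)
  case 0
  then have "vscale (1 / c 0) (\<lambda>j. c 0 * x 0 j) = x 0"
    by (auto simp: vscale_def)
  then show ?case using 0 by simp
next
  case (Suc k)
  define s where "s = (\<Sum>i\<le>k. c i)"
  define y where "y = vscale (1 / s) (\<lambda>j. \<Sum>i\<le>k. c i * x i j)"
  define u where "u = c (Suc k) / (s + c (Suc k))"
  have s: "s > 0" unfolding s_def using Suc.prems(1) by (intro sum_pos) auto
  have c: "c (Suc k) > 0" using Suc.prems(1) by simp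
  have "y \<in> S" unfolding y_def s_def using Suc by simp
  moreover have "x (Suc k) \<in> S" using Suc.prems(2) by simp
  moreover have "0 \<le> u" "u \<le> 1" using s c by (auto simp: u_def)
  ultimately have "(\<lambda>j. (1 - u) * y j + u * x (Suc k) j) \<in> S"
    using assms(1) unfolding convex_n_def by blast
  moreover have "(1 - u) * y j = 1 / (s + c (Suc k)) * (\<Sum>i\<le>k. c i * x i j)" for j
  proof -
    have "1 - u = s / (s + c (Suc k))" using s c by (simp add: u_def field_simps)
    then show ?thesis using s by (simp add: y_def vscale_def)
  qed
  then have "vscale (1 / (\<Sum>i\<le>Suc k. c i)) (\<lambda>j. \<Sum>i\<le>Suc k. c i * x i j)
      = (\<lambda>j. (1 - u) * y j + u * x (Suc k) j)"
    by (auto simp: vscale_def s_def[symmetric] u_def distrib_left)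
  ultimately show ?case by simp
qed

text \<open>For negative arguments, \<open>ln (1 + y) - y + y^2\<close> has derivative
  \<open>y * (1 + 2 * y) / (1 + y)\<close>, whose sign is constant down to -1/2; this is where the
  threshold comes from.\<close>

lemma exp_minus_square_le:
  fixes x :: real
  assumes "\<bar>x\<bar> \<le> 1 / 2"
  shows "exp (x - x\<^sup>2) \<le> 1 + x"
proof -
  have "x - x\<^sup>2 \<le> ln (1 + x)"
  proof (cases "x \<ge> 0")
    case True
    then show ?thesis using assms by (intro ln_one_plus_pos_lower_bound) auto
  next
    case False
    let ?h = "\<lambda>y::real. ln (1 + y) - y + y\<^sup>2"
    have "?h x \<ge> ?h 0"
    proof (rule DERIV_nonpos_imp_nonincreasing[of x 0 ?h])
      fix y assume y: "x \<le> y" "y \<le> 0"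
      have y': "1 + y > 0" "1 + 2 * y \<ge> 0" using assms y by auto
      have "(?h has_real_derivative 1 / (1 + y) - 1 + 2 * y) (at y)"
        using y' by (auto intro!: derivative_eq_intros)
      moreover have "1 / (1 + y) - 1 + 2 * y = y * (1 + 2 * y) / (1 + y)"
        using y' by (simp add: field_simps)
      moreover have "y * (1 + 2 * y) / (1 + y) \<le> 0"
        using y y' by (intro divide_nonpos_pos mult_nonpos_nonneg) auto
      ultimately show "\<exists>D. (?h has_real_derivative D) (at y) \<and> D \<le> 0" by metis
    qed (use False in simp)
    then show ?thesis by simp
  qed
  moreover have "1 + x > 0" using assms by linarith
  ultimately show ?thesis by (metis exp_le_cancel_iff exp_ln)
qed

lemma exponential_weights_pos:
  fixes p f :: "nat \<Rightarrow> nat \<Rightarrow> real"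
  assumes "\<And>i. i \<le> k \<Longrightarrow> p i 1 > 0"
    and "\<And>i t. i \<le> k \<Longrightarrow> t \<in> {1..T} \<Longrightarrow>
      p i (Suc t) = p i t * exp (- f i t) / (\<Sum>j\<le>k. p j t * exp (- f j t))"
    and "t \<le> T" "i \<le> k"
  shows "p i (Suc t) > 0"
  using assms(3,4)
proof (induction t arbitrary: i)
  case 0
  then show ?case using assms(1) by simp
next
  case (Suc t)
  then have "(\<Sum>j\<le>k. p j (Suc t) * exp (- f j (Suc t))) > 0" by (intro sum_pos) auto
  then show ?case using Suc by (simp add: assms(2))
qed

text \<open>The prod inequality \<open>exp (b - b\<^sup>2) \<le> 1 + b\<close> together with the vanishing of the mean of the
  \<open>b i t\<close> shows that every normalisation factor is at most 1, so no weight decays faster than the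
  unnormalised one.\<close>

lemma exponential_weights_regret:
  fixes p f b :: "nat \<Rightarrow> nat \<Rightarrow> real"
  assumes pos: "\<And>i. i \<le> k \<Longrightarrow> p i 1 > 0" and sum1: "(\<Sum>i\<le>k. p i 1) = 1"
    and upd: "\<And>i t. i \<le> k \<Longrightarrow> t \<in> {1..T} \<Longrightarrow>
      p i (Suc t) = p i t * exp (- f i t) / (\<Sum>j\<le>k. p j t * exp (- f j t))"
    and f: "\<And>i t. i \<le> k \<Longrightarrow> t \<in> {1..T} \<Longrightarrow> f i t = - b i t + (b i t)\<^sup>2"
    and small: "\<And>i t. i \<le> k \<Longrightarrow> t \<in> {1..T} \<Longrightarrow> \<bar>b i t\<bar> \<le> 1 / 2"
    and mean0: "\<And>t. t \<in> {1..T} \<Longrightarrow> (\<Sum>i\<le>k. p i t * b i t) = 0"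
    and i: "i \<le> k"
  shows "- (\<Sum>t=1..T. f i t) \<le> ln (1 / p i 1)"
proof -
  have ppos: "p i (Suc t) > 0" if "t \<le> T" "i \<le> k" for i t
    by (rule exponential_weights_pos[OF pos upd that])
  have inv: "(\<Sum>i\<le>k. p i (Suc t)) = 1 \<and> p i 1 * exp (- (\<Sum>s=1..t. f i s)) \<le> p i (Suc t)"
    if "t \<le> T" for t
    using that
  proof (induction t)
    case 0
    then show ?case using sum1 by simp
  next
    case (Suc t)
    define Z where "Z = (\<Sum>j\<le>k. p j (Suc t) * exp (- f j (Suc t)))"
    have t: "Suc t \<in> {1..T}" using Suc.prems by simp
    have IH: "(\<Sum>i\<le>k. p i (Suc t)) = 1" "p i 1 * exp (- (\<Sum>s=1..t. f i s)) \<le> p i (Suc t)"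
      using Suc by auto
    have p: "p j (Suc t) > 0" if "j \<le> k" for j using ppos that Suc.prems by simp
    have Zpos: "Z > 0" unfolding Z_def using p by (intro sum_pos) auto
    have "Z \<le> (\<Sum>j\<le>k. p j (Suc t) * (1 + b j (Suc t)))"
      unfolding Z_def
    proof (intro sum_mono mult_left_mono)
      fix j assume "j \<in> {..k}"
      then show "exp (- f j (Suc t)) \<le> 1 + b j (Suc t)"
        using exp_minus_square_le[OF small[OF _ t, of j]] f[OF _ t, of j] by simp
    qed (use p less_imp_le in auto)
    also have "\<dots> = 1" using IH(1) mean0[OF t] by (simp add: distrib_left sum.distrib)
    finally have Z1: "Z \<le> 1" .
    have new: "p j (Suc (Suc t)) = p j (Suc t) * exp (- f j (Suc t)) / Z" if "j \<le> k" for j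
      using upd[OF that t] by (simp add: Z_def)
    have "(\<Sum>j\<le>k. p j (Suc (Suc t))) = (\<Sum>j\<le>k. p j (Suc t) * exp (- f j (Suc t)) / Z)"
      by (intro sum.cong) (auto simp: new)
    also have "\<dots> = 1"
      using Zpos by (simp add: sum_divide_distrib[symmetric] Z_def)
    finally have "(\<Sum>j\<le>k. p j (Suc (Suc t))) = 1" .
    moreover have "p i 1 * exp (- (\<Sum>s=1..Suc t. f i s)) \<le> p i (Suc (Suc t))"
    proof -
      have "p i 1 * exp (- (\<Sum>s=1..Suc t. f i s)) = p i 1 * exp (- (\<Sum>s=1..t. f i s)) * exp (- f i (Suc t))"
        by (simp add: exp_add[symmetric] mult.assoc)
      also have "\<dots> \<le> p i (Suc t) * exp (- f i (Suc t))"
        using IH(2) by (intro mult_right_mono) auto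
      also have "\<dots> \<le> p i (Suc t) * exp (- f i (Suc t)) / Z"
        using Zpos Z1 p[OF i] by (simp add: field_simps)
      finally show ?thesis using new[OF i] by simp
    qed
    ultimately show ?case by blast
  qed
  have "p i (Suc T) \<le> (\<Sum>i\<le>k. p i (Suc T))"
    using i ppos less_imp_le by (intro member_le_sum) auto
  then have "p i 1 * exp (- (\<Sum>t=1..T. f i t)) \<le> 1"
    using inv[of T] by simp
  then have "exp (- (\<Sum>t=1..T. f i t)) \<le> 1 / p i 1"
    using pos[OF i] by (simp add: field_simps)
  then show ?thesis
    using pos[OF i] by (simp add: ln_ge_iff)
qed

section \<open>The prior and the geometric grid of learning rates\<close>

lemma mg_prior_pos: "mg_prior T i > 0"
  by (simp add: mg_prior_def add_pos_nonneg)

lemma sum_inverse_consecutive: "(\<Sum>i\<le>k. 1 / (real (i + 1) * real (i + 2))) = 1 - 1 / real (k + 2)"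
proof (induction k)
  case (Suc k)
  have "1 - 1 / real (k + 2) + 1 / (real (Suc k + 1) * real (Suc k + 2)) = 1 - 1 / real (Suc k + 2)"
    by (simp add: divide_simps) (simp add: algebra_simps)
  then show ?case by (simp only: sum.atMost_Suc Suc.IH)
qed simp

text \<open>With \<open>k = mg_k T\<close> the leading constant of the prior is (k+2)/(k+1), the
  reciprocal of the telescoped sum.\<close>

lemma sum_mg_prior: "(\<Sum>i\<le>mg_k T. mg_prior T i) = 1"
proof -
  have "(1 + 1 / (1 + x)) * (1 - 1 / (x + 2)) = 1" if "x \<ge> 0" for x :: real
    using that by (simp add: divide_simps)
  from this[of "real (mg_k T)"]
  have "(1 + 1 / (1 + real (mg_k T))) * (1 - 1 / real (mg_k T + 2)) = 1"
    by (simp add: add.commute)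
  moreover have "(\<Sum>i\<le>mg_k T. mg_prior T i)
      = (1 + 1 / (1 + real (mg_k T))) * (\<Sum>i\<le>mg_k T. 1 / (real (i + 1) * real (i + 2)))"
    by (simp add: mg_prior_def sum_distrib_left)
  ultimately show ?thesis
    by (simp only: sum_inverse_consecutive)
qed

text \<open>The crude estimate \<open>i + 1 <= 2 ^ i\<close> puts the cost of the prior into powers
  of 4, the scale in which the grid index is selected.\<close>

lemma ln_inverse_mg_prior_le: "ln (1 / mg_prior T i) \<le> ln (2 * 4 ^ i)"
proof -
  have i: "real (i + 1) \<le> 2 ^ i"
    by (induction i) auto
  have "1 / mg_prior T i = (real (i + 1) * real (i + 2)) / (1 + 1 / (1 + real (mg_k T)))"
    by (simp add: mg_prior_def)
  also have "\<dots> \<le> real (i + 1) * real (i + 2) / 1"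
    by (intro divide_left_mono) (auto intro!: add_pos_nonneg)
  also have "\<dots> \<le> 2 ^ i * (2 * 2 ^ i)"
    using i by (simp only: div_by_1, intro mult_mono) auto
  also have "\<dots> = 2 * 4 ^ i"
    by (simp add: power_mult_distrib[symmetric])
  finally show ?thesis using mg_prior_pos[of T i] by (intro ln_mono) auto
qed

text \<open>Take the least admissible \<open>i\<close>: minimality gives the upper bound on
  \<open>4 ^ i\<close>, and the rounding up in \<open>mg_k\<close> ensures that the grid reaches
  \<open>T\<close>.\<close>

lemma grid_index_exists:
  assumes "T > 0" and "q \<le> real T"
  shows "\<exists>i\<le>mg_k T. q \<le> 4 ^ i \<and> (i = 0 \<or> 4 ^ i < 4 * q)"
proof -
  have "real T = 2 powr (2 * (log 2 (real T) / 2))" using assms by simp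
  also have "\<dots> \<le> 2 powr (2 * real (mg_k T))"
    unfolding mg_k_def by (intro powr_mono mult_left_mono real_nat_ceiling_ge) auto
  also have "\<dots> = 4 ^ mg_k T"
    by (simp add: powr_powr[symmetric] powr_realpow)
  finally have ex: "q \<le> 4 ^ mg_k T" using assms(2) by linarith
  define i where "i = (LEAST i. q \<le> 4 ^ i)"
  have "q \<le> 4 ^ i" unfolding i_def by (rule LeastI[where P = "\<lambda>i. q \<le> 4 ^ i", OF ex])
  moreover have "i \<le> mg_k T" unfolding i_def by (rule Least_le[where P = "\<lambda>i. q \<le> 4 ^ i", OF ex])
  moreover have "i = 0 \<or> 4 ^ i < 4 * q"
  proof (cases i)
    case (Suc j)
    then have "\<not> q \<le> 4 ^ j" unfolding i_def by (intro not_less_Least) simp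
    then show ?thesis by (simp add: Suc)
  qed simp
  ultimately show ?thesis by blast
qed

text \<open>The learning rate is the largest grid point that is at most \<open>sqrt (M / (B * S)) / 5\<close>.  The
  cost of the prior stays below \<open>M\<close> up to a constant because only indices \<open>i\<close> with
  \<open>4 ^ i < 4 * exp M\<close> are used.\<close>

lemma learning_rate_tuning:
  fixes R S B M :: real
  assumes T: "T > 0" and B: "B > 0" and M: "M \<ge> 1" and S: "S \<ge> 0" "S \<le> real T * B" "S \<le> B * M * exp M"
    and regret: "\<And>i. i \<le> mg_k T \<Longrightarrow>
      mg_eta B i * R - (mg_eta B i)\<^sup>2 * (B * (R + 2 * S)) \<le> ln (1 / mg_prior T i) + 4 * M"
  shows "R \<le> 102 * (B * M + sqrt (S * (B * M)))"
proof (cases "R \<le> 0")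
  case True
  then show ?thesis
    by (rule order_trans) (use B M S in simp)
next
  case False
  define q where "q = S / (B * M)"
  have BM: "B * M > 0" using B M by simp
  have q0: "q \<ge> 0" using S BM by (simp add: q_def)
  have "S \<le> real T * (B * M)"
    using S(2) B M T by (smt (verit) mult_left_mono mult_le_cancel_left1 of_nat_0_less_iff)
  then have qT: "q \<le> real T" using BM by (simp add: q_def field_simps)
  obtain i where i: "i \<le> mg_k T" "q \<le> 4 ^ i" "i = 0 \<or> 4 ^ i < 4 * q"
    using grid_index_exists[OF T qT] by blast
  define h where "h = (2::real) ^ i"
  have h1: "h \<ge> 1" by (simp add: h_def)
  have hh: "h\<^sup>2 = 4 ^ i" by (simp add: h_def power2_eq_square power_mult_distrib[symmetric])
  have h_le: "h \<le> 1 + 2 * sqrt q"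
    using i(3)
  proof
    assume "4 ^ i < 4 * q"
    then have "sqrt (h\<^sup>2) \<le> sqrt (4 * q)" unfolding hh by (intro real_sqrt_le_mono) simp
    then show ?thesis using h1 by (simp add: real_sqrt_mult)
  qed (use q0 in \<open>simp add: h_def\<close>)
  have prior: "ln (1 / mg_prior T i) \<le> 4 * M"
    using i(3)
  proof
    assume "i = 0"
    then have "ln (1 / mg_prior T i) \<le> ln 2" using ln_inverse_mg_prior_le[of T i] by simp
    then show ?thesis using M ln_2_less_1 by linarith
  next
    assume less: "4 ^ i < 4 * q"
    have "ln (1 / mg_prior T i) \<le> ln (2 * 4 ^ i)" by (rule ln_inverse_mg_prior_le)
    also have "\<dots> \<le> ln (2 ^ 3 * exp M)"
    proof (intro ln_mono)
      have "q \<le> exp M" using S(3) BM by (simp add: q_def field_simps)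
      then show "2 * 4 ^ i \<le> 2 ^ 3 * exp M" using less by simp
    qed auto
    also have "\<dots> = 3 * ln 2 + M" by (simp only: ln_mult_pos ln_realpow zero_less_power
          exp_gt_zero ln_exp zero_less_numeral of_nat_numeral)
    finally show ?thesis using M ln_2_less_1 by linarith
  qed
  define \<eta> where "\<eta> = mg_eta B i"
  have \<eta>: "\<eta> = 1 / (5 * B * h)" by (simp add: \<eta>_def mg_eta_def h_def)
  have "\<eta> * R - \<eta>\<^sup>2 * (B * (R + 2 * S)) \<le> 8 * M"
    using regret[OF i(1)] prior by (simp add: \<eta>_def)
  then have "5 * B * h * (\<eta> * R - \<eta>\<^sup>2 * (B * (R + 2 * S))) \<le> 5 * B * h * (8 * M)"
    using B h1 by (intro mult_left_mono) auto
  moreover have "5 * B * h * (\<eta> * R - \<eta>\<^sup>2 * (B * (R + 2 * S))) = R - (R + 2 * S) / (5 * h)"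
    using B h1 by (simp add: \<eta> field_simps power2_eq_square)
  \<comment> \<open>The self-bounding part of the quadratic term is absorbed on the left, which
    leaves 4/5 of \<open>R\<close>.\<close>
  moreover have "R / (5 * h) \<le> R / 5" using False h1 by (intro divide_left_mono) auto
  moreover have "S / (5 * h) \<le> h * (B * M) / 5"
  proof -
    have "S \<le> h\<^sup>2 * (B * M)" using i(2) BM by (simp add: hh q_def field_simps)
    then show ?thesis using h1 by (simp add: field_simps power2_eq_square)
  qed
  \<comment> \<open>40 is 5 times 8, and 2/5 comes from the term in \<open>2 * S\<close>. Dividing
    by 4/5 gives 101/2, rounded up to 51; the factor 2 in \<open>h_le\<close> doubles this to
    102.\<close>
  ultimately have "4 / 5 * R \<le> (40 + 2 / 5) * (h * (B * M))"
    by (simp add: add_divide_distrib algebra_simps)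
  then have "R \<le> (101 / 2) * (h * (B * M))" by (simp add: mult_ac)
  also have "\<dots> \<le> 51 * (h * (B * M))" using BM h1 by (intro mult_right_mono) auto
  also have "\<dots> \<le> 51 * ((1 + 2 * sqrt q) * (B * M))"
    using h_le BM by (intro mult_left_mono mult_right_mono) auto
  also have "sqrt q * (B * M) = sqrt (S * (B * M))"
  proof -
    have "sqrt q * (B * M) = sqrt (q * (B * M)\<^sup>2)" using BM by (simp add: real_sqrt_mult)
    also have "q * (B * M)\<^sup>2 = S * (B * M)" using B M by (simp add: q_def power2_eq_square)
    finally show ?thesis .
  qed
  then have "51 * ((1 + 2 * sqrt q) * (B * M)) = 51 * (B * M) + 102 * sqrt (S * (B * M))"
    by (simp add: algebra_simps)
  finally show ?thesis using BM by (simp add: distrib_left)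
qed

section \<open>Regret of MetaGrad\<close>

text \<open>Compactness bounds the image from above, so that \<open>Sup\<close> really is an upper
  bound.\<close>

lemma subopt_loss_ge:
  assumes "compact X" and "x \<in> X"
  shows "ip n c (vsub x xt) \<le> subopt_loss n X xt c"
proof -
  have "continuous_on X (ip n c)"
    unfolding ip_def
    by (intro continuous_intros continuous_on_subset[OF continuous_on_product_coordinates]) simp
  then have "bdd_above (ip n c ` X)"
    using assms(1) by (intro bounded_imp_bdd_above compact_imp_bounded compact_continuous_image)
  then have "ip n c x \<le> Sup (ip n c ` X)"
    using assms(2) by (intro cSup_upper) auto
  then show ?thesis by (simp add: subopt_loss_def ip_vsub_right)
qed

locale metagrad =
  fixes n T :: nat and \<Theta> :: "(nat \<Rightarrow> real) set" and cstar :: "nat \<Rightarrow> real"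
    and X :: "nat \<Rightarrow> (nat \<Rightarrow> real) set" and xs :: "nat \<Rightarrow> nat \<Rightarrow> real" and D K B :: real
    and chat xhat :: "nat \<Rightarrow> nat \<Rightarrow> real" and w :: "nat \<Rightarrow> nat \<Rightarrow> nat \<Rightarrow> real"
    and A :: "nat \<Rightarrow> nat \<Rightarrow> nat \<Rightarrow> nat \<Rightarrow> real" and p :: "nat \<Rightarrow> nat \<Rightarrow> real"
  assumes n: "n > 0" and T: "T > 0" and conv: "convex_n \<Theta>" and cstar: "cstar \<in> \<Theta>"
    and X: "\<And>t. t \<in> {1..T} \<Longrightarrow> compact (X t)" "\<And>t. t \<in> {1..T} \<Longrightarrow> xs t \<in> X t"
    and D: "D > 0" and K: "K > 0" and B: "B > 0"
    and diam_\<Theta>: "\<And>c c'. c \<in> \<Theta> \<Longrightarrow> c' \<in> \<Theta> \<Longrightarrow> l2dist n c c' \<le> D"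
    and diam_X: "\<And>t x x'. t \<in> {1..T} \<Longrightarrow> x \<in> X t \<Longrightarrow> x' \<in> X t \<Longrightarrow> l2dist n x x' \<le> K"
    and ip_le_B: "\<And>t c c' x x'. t \<in> {1..T} \<Longrightarrow> c \<in> \<Theta> \<Longrightarrow> c' \<in> \<Theta> \<Longrightarrow> x \<in> X t \<Longrightarrow> x' \<in> X t
      \<Longrightarrow> ip n (vsub c c') (vsub x x') \<le> B"
    and run: "metagrad_run n T \<Theta> D B X xs chat xhat w A p"
begin

abbreviation "\<eta> \<equiv> mg_eta B"

abbreviation "\<gamma> i \<equiv> ons_gamma B (\<eta> i)"

definition g :: "nat \<Rightarrow> nat \<Rightarrow> real" where "g t = vsub (xhat t) (xs t)"

definition grad :: "nat \<Rightarrow> nat \<Rightarrow> nat \<Rightarrow> real" where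
  "grad i t = vadd (vscale (\<eta> i) (g t))
     (vscale (2 * (\<eta> i)\<^sup>2 * ip n (vsub (w i t) (chat t)) (g t)) (g t))"

definition surrogate :: "nat \<Rightarrow> nat \<Rightarrow> (nat \<Rightarrow> real) \<Rightarrow> real" where
  "surrogate i t v = - \<eta> i * ip n (vsub (chat t) v) (g t) + (\<eta> i)\<^sup>2 * (ip n (vsub (chat t) v) (g t))\<^sup>2"

definition inst_regret :: "nat \<Rightarrow> real" where "inst_regret t = ip n (vsub (chat t) cstar) (g t)"

text \<open>The truncation at \<open>exp 1\<close> makes \<open>L\<close> at least 1, so that
  constants and multiples of \<open>n\<close> are absorbed by \<open>n * L\<close>.\<close>

definition L :: real where "L = ln (max (exp 1) (D * K * real T / (B * real n)))"

lemma
  shows w_init: "i \<le> mg_k T \<Longrightarrow> w i 1 \<in> \<Theta>"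
    and A_init: "i \<le> mg_k T \<Longrightarrow> A i 0 = mscale (ons_eps n D (\<gamma> i)) (idmat n)"
    and p_init: "i \<le> mg_k T \<Longrightarrow> p i 1 = mg_prior T i"
    and chat_eq: "t \<in> {1..T} \<Longrightarrow> chat t = vscale (1 / (\<Sum>i\<le>mg_k T. \<eta> i * p i t))
      (\<lambda>j. \<Sum>i\<le>mg_k T. \<eta> i * p i t * w i t j)"
    and xhat_in: "t \<in> {1..T} \<Longrightarrow> xhat t \<in> X t"
    and xhat_argmax: "t \<in> {1..T} \<Longrightarrow> x \<in> X t \<Longrightarrow> ip n (chat t) x \<le> ip n (chat t) (xhat t)"
    and A_step: "i \<le> mg_k T \<Longrightarrow> t \<in> {1..T} \<Longrightarrow> A i t = madd (A i (t - 1)) (outer (grad i t))"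
    and w_step: "i \<le> mg_k T \<Longrightarrow> t \<in> {1..T} \<Longrightarrow> w i (Suc t) \<in> \<Theta>"
    and w_proj: "i \<le> mg_k T \<Longrightarrow> t \<in> {1..T} \<Longrightarrow> v \<in> \<Theta> \<Longrightarrow>
      sqnorm_A n (A i t) (vsub (vsub (w i t) (vscale (1 / \<gamma> i) (mv n (minv n (A i t)) (grad i t)))) (w i (Suc t)))
      \<le> sqnorm_A n (A i t) (vsub (vsub (w i t) (vscale (1 / \<gamma> i) (mv n (minv n (A i t)) (grad i t)))) v)"
    and p_step: "i \<le> mg_k T \<Longrightarrow> t \<in> {1..T} \<Longrightarrow> p i (Suc t) = p i t * exp (- surrogate i t (w i t))
      / (\<Sum>j\<le>mg_k T. p j t * exp (- surrogate j t (w j t)))"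
  using run unfolding metagrad_run_def Let_def g_def[symmetric] grad_def[symmetric] surrogate_def[symmetric]
  by blast+

section \<open>Elementary bounds along a run\<close>

lemma \<eta>_pos: "\<eta> i > 0"
  using B by (simp add: mg_eta_def)

lemma \<eta>_B_le: "\<eta> i * B \<le> 1 / 5"
  using B by (simp add: mg_eta_def)

lemma p_init_pos: "i \<le> mg_k T \<Longrightarrow> p i 1 > 0"
  by (simp only: p_init mg_prior_pos)

lemma p_pos: "i \<le> mg_k T \<Longrightarrow> t \<in> {1..T} \<Longrightarrow> p i t > 0"
  using exponential_weights_pos[where f = "\<lambda>i t. surrogate i t (w i t)" and p = p and k = "mg_k T"
      and T = T and t = "t - 1" and i = i, OF p_init_pos p_step] by auto

lemma w_in:
  assumes "i \<le> mg_k T" "t \<in> {1..T}"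
  shows "w i t \<in> \<Theta>"
proof (cases "t = 1")
  case True
  then show ?thesis using w_init assms(1) by simp
next
  case False
  then obtain s where "t = Suc s" "s \<in> {1..T}" using assms(2) by (cases t) auto
  then show ?thesis using w_step assms(1) by simp
qed

lemma chat_in: "t \<in> {1..T} \<Longrightarrow> chat t \<in> \<Theta>"
  by (subst chat_eq, simp, rule convex_n_weighted_mean[OF conv])
    (auto simp: w_in p_pos \<eta>_pos)

lemma abs_ip_g_le_B:
  assumes "t \<in> {1..T}" "c \<in> \<Theta>" "c' \<in> \<Theta>"
  shows "\<bar>ip n (vsub c c') (g t)\<bar> \<le> B"
proof -
  have "ip n (vsub c c') (g t) \<le> B" "ip n (vsub c' c) (g t) \<le> B"
    using assms xhat_in X(2) unfolding g_def by (auto intro!: ip_le_B)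
  then show ?thesis by (simp add: ip_vsub_left abs_le_iff)
qed

lemma ip_g_g_le: "t \<in> {1..T} \<Longrightarrow> ip n (g t) (g t) \<le> K\<^sup>2"
  unfolding g_def ip_eq_l2dist
  by (intro power_mono diam_X) (auto simp: xhat_in X(2) l2dist_def sum_nonneg)

text \<open>A bound free of \<open>B\<close>, by Cauchy--Schwarz. It is what ties the negative
  regret to the argument of the logarithm in \<open>L\<close>.\<close>

lemma abs_ip_g_le_DK:
  assumes "t \<in> {1..T}" "c \<in> \<Theta>" "c' \<in> \<Theta>"
  shows "\<bar>ip n (vsub c c') (g t)\<bar> \<le> D * K"
proof -
  have "(ip n (vsub c c') (g t))\<^sup>2 \<le> ip n (vsub c c') (vsub c c') * ip n (g t) (g t)"
    by (rule ip_Cauchy_Schwarz)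
  also have "\<dots> \<le> D\<^sup>2 * K\<^sup>2"
    using assms unfolding ip_eq_l2dist
    by (intro mult_mono power_mono diam_\<Theta> ip_g_g_le) (auto simp: l2dist_def sum_nonneg ip_self_nonneg)
  finally show ?thesis using D K by (metis abs_le_square_iff abs_of_pos mult_pos_pos power_mult_distrib)
qed

lemma expert_weight_bound:
  assumes i: "i \<le> mg_k T"
  shows "- (\<Sum>t=1..T. surrogate i t (w i t)) \<le> ln (1 / mg_prior T i)"
proof -
  define b where "b i t = \<eta> i * ip n (vsub (chat t) (w i t)) (g t)" for i t
  have "- (\<Sum>t=1..T. surrogate i t (w i t)) \<le> ln (1 / p i 1)"
  proof (rule exponential_weights_regret[where b = b and p = p and k = "mg_k T"])
    show "(\<Sum>i\<le>mg_k T. p i 1) = 1"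
      unfolding sum_mg_prior[of T, symmetric] by (intro sum.cong) (auto simp only: p_init atMost_iff)
    show "\<bar>b i t\<bar> \<le> 1 / 2" if "i \<le> mg_k T" "t \<in> {1..T}" for i t
    proof -
      have "\<bar>b i t\<bar> \<le> \<eta> i * B"
        unfolding b_def abs_mult using \<eta>_pos[of i] that
        by (auto intro!: mult_left_mono abs_ip_g_le_B chat_in w_in)
      then show ?thesis using \<eta>_B_le[of i] by simp
    qed
    \<comment> \<open>The reason for playing the mean with weights \<open>\<eta> i * p i t\<close>
      instead of \<open>p i t\<close>: the linear parts of the surrogate losses cancel.\<close>
    show "(\<Sum>i\<le>mg_k T. p i t * b i t) = 0" if t: "t \<in> {1..T}" for t
    proof -
      let ?c = "\<lambda>i. \<eta> i * p i t"
      have s: "(\<Sum>i\<le>mg_k T. ?c i) > 0"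
        using t by (intro sum_pos mult_pos_pos \<eta>_pos p_pos) auto
      have "ip n (\<lambda>j. \<Sum>i\<le>mg_k T. ?c i * w i t j) (g t) = (\<Sum>i\<le>mg_k T. ?c i * ip n (w i t) (g t))"
        unfolding ip_def sum_distrib_left sum_distrib_right
        by (subst sum.swap) (simp add: mult.assoc)
      then have "(\<Sum>i\<le>mg_k T. ?c i) * ip n (chat t) (g t) = (\<Sum>i\<le>mg_k T. ?c i * ip n (w i t) (g t))"
        using s by (subst chat_eq[OF t]) (simp add: ip_vscale_left)
      moreover have "(\<Sum>i\<le>mg_k T. p i t * b i t)
          = (\<Sum>i\<le>mg_k T. ?c i * (ip n (chat t) (g t) - ip n (w i t) (g t)))"
        by (simp add: b_def ip_vsub_left mult_ac)
      ultimately show ?thesis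
        by (simp only: right_diff_distrib sum_subtractf sum_distrib_right diff_self)
    qed
  qed (use p_init_pos p_step i in \<open>auto simp: surrogate_def b_def power_mult_distrib\<close>)
  then show ?thesis using i by (simp only: p_init)
qed

section \<open>Exp-concavity and Online Newton Step regret of one expert\<close>

lemma grad_factor_bounds: "1 \<le> 1 + 2 * \<eta> i * B" "1 + 2 * \<eta> i * B \<le> 7 / 5"
  using \<eta>_B_le[of i] mult_pos_pos[OF \<eta>_pos[of i] B] by linarith+

lemma grad_factor_sq_ge_1: "1 \<le> (1 + 2 * \<eta> i * B)\<^sup>2"
  using grad_factor_bounds(1) by (rule one_le_power)

lemma \<gamma>_pos: "\<gamma> i > 0"
  using grad_factor_sq_ge_1[of i] unfolding ons_gamma_def by (intro divide_pos_pos) linarith+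

lemma \<gamma>_le_1: "\<gamma> i \<le> 1"
  using grad_factor_sq_ge_1[of i] unfolding ons_gamma_def by (subst divide_le_eq_1_pos) linarith+

text \<open>The factor 5 in the grid yields (7/5)^2 / 2 = 49/50.\<close>

lemma inverse_\<gamma>_le: "1 / (2 * \<gamma> i) \<le> 1"
proof -
  have "(1 + 2 * \<eta> i * B)\<^sup>2 \<le> (7 / 5)\<^sup>2"
    using grad_factor_bounds[of i] by (intro power_mono) auto
  then show ?thesis by (simp add: ons_gamma_def power2_eq_square)
qed

lemma grad_eq: "grad i t = vscale (\<eta> i * (1 + 2 * \<eta> i * ip n (vsub (w i t) (chat t)) (g t))) (g t)"
  by (auto simp: grad_def vadd_def vscale_def algebra_simps power2_eq_square)

lemma grad_factor_le:
  assumes "i \<le> mg_k T" "t \<in> {1..T}"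
  shows "(1 + 2 * \<eta> i * ip n (vsub (w i t) (chat t)) (g t))\<^sup>2 \<le> (1 + 2 * \<eta> i * B)\<^sup>2"
proof -
  have "\<bar>2 * \<eta> i * ip n (vsub (w i t) (chat t)) (g t)\<bar> \<le> 2 * \<eta> i * B"
    unfolding abs_mult using \<eta>_pos[of i] assms
    by (auto intro!: mult_left_mono abs_ip_g_le_B chat_in w_in)
  then have "\<bar>1 + 2 * \<eta> i * ip n (vsub (w i t) (chat t)) (g t)\<bar> \<le> \<bar>1 + 2 * \<eta> i * B\<bar>"
    by linarith
  then show ?thesis by (simp add: abs_le_square_iff)
qed

text \<open>The surrogate is a quadratic in \<open>ip n v (g t)\<close>, so its gap is exactly the
  linear term minus \<open>(\<eta> i * d)^2\<close>. The gradient is \<open>\<eta> i * q\<close>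
  times \<open>g t\<close> with \<open>q^2\<close> at most the inverse of \<open>\<gamma> i\<close>,
  so this square covers the curvature term.\<close>

lemma surrogate_exp_concave:
  assumes i: "i \<le> mg_k T" and t: "t \<in> {1..T}"
  shows "surrogate i t (w i t) - surrogate i t v
    \<le> ip n (grad i t) (vsub (w i t) v) - \<gamma> i / 2 * (ip n (grad i t) (vsub (w i t) v))\<^sup>2"
proof -
  define d where "d = ip n (vsub (w i t) v) (g t)"
  define s where "s = ip n (vsub (w i t) (chat t)) (g t)"
  define q where "q = 1 + 2 * \<eta> i * s"
  have gr: "ip n (grad i t) (vsub (w i t) v) = \<eta> i * q * d"
    by (simp add: grad_eq ip_vscale_left ip_commute[of n "g t"] d_def q_def s_def)
  have "surrogate i t (w i t) - surrogate i t v = \<eta> i * q * d - (\<eta> i * d)\<^sup>2"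
  proof -
    have eq: "ip n (vsub (chat t) (w i t)) (g t) = - s" "ip n (vsub (chat t) v) (g t) = d - s"
      by (simp_all add: s_def d_def ip_vsub_left)
    show ?thesis unfolding surrogate_def q_def eq by (simp add: power2_eq_square algebra_simps)
  qed
  moreover have "\<gamma> i / 2 * (\<eta> i * q * d)\<^sup>2 \<le> (\<eta> i * d)\<^sup>2"
  proof -
    have "q\<^sup>2 \<le> (1 + 2 * \<eta> i * B)\<^sup>2" using grad_factor_le[OF i t] by (simp add: q_def s_def)
    then have "\<gamma> i * q\<^sup>2 \<le> 1"
      using grad_factor_sq_ge_1[of i] unfolding ons_gamma_def times_divide_eq_left mult_1_left
      by (subst divide_le_eq_1_pos) linarith+
    then have "\<gamma> i / 2 * q\<^sup>2 * (\<eta> i * d)\<^sup>2 \<le> 1 * (\<eta> i * d)\<^sup>2" by (intro mult_right_mono) auto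
    then show ?thesis by (simp add: power_mult_distrib mult_ac)
  qed
  ultimately show ?thesis by (simp add: gr)
qed

lemma L_ge_1: "L \<ge> 1"
  unfolding L_def by (subst ln_ge_iff) (auto simp: less_max_iff_disj)

lemma exp_L: "exp L = max (exp 1) (D * K * real T / (B * real n))"
  unfolding L_def by (subst exp_ln) (auto simp: less_max_iff_disj)

lemma expert_ons_bound:
  assumes i: "i \<le> mg_k T" and nT: "n \<le> T"
  shows "(\<Sum>t=1..T. surrogate i t (w i t) - surrogate i t cstar) \<le> 4 * (real n * L)"
proof -
  define e where "e = ons_eps n D (\<gamma> i)"
  have e: "e > 0" using n D \<gamma>_pos[of i] by (simp add: e_def ons_eps_def)
  have log_le: "ln (1 + (\<Sum>t=1..T. (grad i t j)\<^sup>2) / e) \<le> 1 + 2 * L" if j: "j < n" for j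
  proof -
    have "(grad i t j)\<^sup>2 \<le> (K / B)\<^sup>2" if t: "t \<in> {1..T}" for t
    proof -
      have "(g t j)\<^sup>2 \<le> ip n (g t) (g t)"
        using member_le_sum[of j "{..<n}" "\<lambda>j. g t j * g t j"] j by (simp add: ip_def power2_eq_square)
      then have gj: "(g t j)\<^sup>2 \<le> K\<^sup>2" using ip_g_g_le[OF t] by simp
      have "(grad i t j)\<^sup>2 = (\<eta> i)\<^sup>2 * (1 + 2 * \<eta> i * ip n (vsub (w i t) (chat t)) (g t))\<^sup>2 * (g t j)\<^sup>2"
        by (simp add: grad_eq vscale_def power_mult_distrib)
      \<comment> \<open>The gradient factor is at most 7/5; the weaker 5 is used because it cancels
        the 5 of the learning rate.\<close>
      also have "\<dots> \<le> (1 / (5 * B))\<^sup>2 * 5\<^sup>2 * K\<^sup>2"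
      proof (intro mult_mono gj)
        show "(\<eta> i)\<^sup>2 \<le> (1 / (5 * B))\<^sup>2"
          using \<eta>_pos[of i] \<eta>_B_le[of i] B by (intro power_mono) (auto simp: field_simps)
        show "(1 + 2 * \<eta> i * ip n (vsub (w i t) (chat t)) (g t))\<^sup>2 \<le> 5\<^sup>2"
          using grad_factor_bounds[of i]
          by (intro order_trans[OF grad_factor_le[OF i t] power_mono]) auto
      qed auto
      also have "\<dots> = (K / B)\<^sup>2" by (simp add: power_mult_distrib power_divide)
      finally show ?thesis .
    qed
    then have "(\<Sum>t=1..T. (grad i t j)\<^sup>2) \<le> real T * (K / B)\<^sup>2"
      using sum_bounded_above[of "{1..T}" "\<lambda>t. (grad i t j)\<^sup>2" "(K / B)\<^sup>2"] by simp
    then have "(\<Sum>t=1..T. (grad i t j)\<^sup>2) / e \<le> real T * (K / B)\<^sup>2 / e"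
      using e by (intro divide_right_mono) auto
    also have "\<dots> = real T * (D * K / B)\<^sup>2 / real n * (\<gamma> i)\<^sup>2"
      by (simp add: e_def ons_eps_def power_mult_distrib power_divide)
    also have "\<dots> \<le> real T * (D * K / B)\<^sup>2 / real n * 1"
      using \<gamma>_pos[of i] \<gamma>_le_1[of i] by (intro mult_left_mono) (auto simp: power_le_one)
    also have "\<dots> = (D * K / B)\<^sup>2 * (real T / real n)" by simp
    \<comment> \<open>Here \<open>n <= T\<close> enters: squaring the ratio turns the bound into the
      square of the argument of the logarithm in \<open>L\<close>.\<close>
    also have "\<dots> \<le> (D * K / B)\<^sup>2 * (real T / real n)\<^sup>2"
    proof (intro mult_left_mono)
      have "real T / real n \<ge> 1" using n nT by simp
      then show "real T / real n \<le> (real T / real n)\<^sup>2"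
        by (rule self_le_power) simp
    qed simp
    also have "\<dots> = (D * K * real T / (B * real n))\<^sup>2" by (simp add: power_mult_distrib power_divide)
    also have "\<dots> \<le> (exp L)\<^sup>2"
      unfolding exp_L using D K B by (intro power_mono) auto
    finally have *: "(\<Sum>t=1..T. (grad i t j)\<^sup>2) / e \<le> (exp L)\<^sup>2" .
    have nonneg: "(\<Sum>t=1..T. (grad i t j)\<^sup>2) / e \<ge> 0" using e by (simp add: sum_nonneg)
    have "1 + (\<Sum>t=1..T. (grad i t j)\<^sup>2) / e \<le> 2 * (exp L)\<^sup>2"
      using * one_le_power[of "exp L" 2] L_ge_1 one_le_exp_iff[of L] by linarith
    also have "\<dots> \<le> exp 1 * (exp L)\<^sup>2"
      using exp_ge_add_one_self[of 1] by (intro mult_right_mono) auto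
    also have "\<dots> = exp (1 + 2 * L)" by (simp add: exp_add exp_double)
    finally have "ln (1 + (\<Sum>t=1..T. (grad i t j)\<^sup>2) / e) \<le> ln (exp (1 + 2 * L))"
      using nonneg by (intro ln_mono) linarith+
    then show ?thesis by simp
  qed
  have "(\<Sum>t=1..T. surrogate i t (w i t) - surrogate i t cstar)
      \<le> (\<Sum>t=1..T. ip n (grad i t) (vsub (w i t) cstar) - \<gamma> i / 2 * (ip n (grad i t) (vsub (w i t) cstar))\<^sup>2)"
    using i by (intro sum_mono surrogate_exp_concave)
  also have "\<dots> \<le> \<gamma> i / 2 * e * (l2dist n (w i 1) cstar)\<^sup>2
      + 1 / (2 * \<gamma> i) * (\<Sum>j<n. ln (1 + (\<Sum>t=1..T. (grad i t j)\<^sup>2) / e))"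
    by (rule ons_regret[OF e \<gamma>_pos conv cstar A_init[OF i, folded e_def] A_step[OF i] w_step[OF i] w_proj[OF i]])
  \<comment> \<open>By the choice of \<open>ons_eps\<close> the initial distance costs at most
    \<open>n / (2 * \<gamma> i)\<close>; together with the \<open>n\<close> logarithms this makes
    \<open>2 * n + 2 * n * L\<close>.\<close>
  also have "\<dots> \<le> real n + 1 * (\<Sum>j<n. 1 + 2 * L)"
  proof (intro add_mono mult_mono sum_mono)
    have "\<gamma> i / 2 * e * (l2dist n (w i 1) cstar)\<^sup>2 \<le> \<gamma> i / 2 * e * D\<^sup>2"
      using \<gamma>_pos[of i] e diam_\<Theta>[OF w_init[OF i] cstar]
      by (intro mult_left_mono power_mono) (auto simp: l2dist_def sum_nonneg)
    also have "\<dots> = 1 / (2 * \<gamma> i) * real n"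
      using D \<gamma>_pos[of i] by (simp add: e_def ons_eps_def power2_eq_square)
    also have "\<dots> \<le> 1 * real n" using inverse_\<gamma>_le by (intro mult_right_mono) auto
    finally show "\<gamma> i / 2 * e * (l2dist n (w i 1) cstar)\<^sup>2 \<le> real n" by simp
    show "0 \<le> (\<Sum>j<n. ln (1 + (\<Sum>t=1..T. (grad i t j)\<^sup>2) / e))"
      using e by (intro sum_nonneg ln_ge_zero) (auto simp: sum_nonneg)
  qed (use inverse_\<gamma>_le log_le in auto)
  also have "\<dots> = 2 * (real n * 1) + 2 * (real n * L)" by (simp add: algebra_simps)
  also have "\<dots> \<le> 2 * (real n * L) + 2 * (real n * L)"
    using L_ge_1 by (intro add_mono mult_left_mono) auto
  finally show ?thesis by simp
qed

text \<open>Split off \<open>ip n (chat t) (g t)\<close>, which is nonnegative since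
  \<open>xhat t\<close> is a best response to \<open>chat t\<close>; the rest compares
  \<open>xhat t\<close> with the maximum for \<open>cstar\<close>.\<close>

lemma neg_inst_regret_le_subopt_loss:
  assumes "t \<in> {1..T}"
  shows "- inst_regret t \<le> subopt_loss n (X t) (xs t) cstar"
proof -
  have "ip n cstar (g t) \<le> subopt_loss n (X t) (xs t) cstar"
    unfolding g_def using assms by (intro subopt_loss_ge X xhat_in)
  moreover have "ip n (chat t) (g t) \<ge> 0"
    using xhat_argmax[OF assms X(2)[OF assms]] by (simp add: g_def ip_vsub_right)
  ultimately show ?thesis by (simp add: inst_regret_def ip_vsub_left)
qed

lemma subopt_loss_nonneg:
  assumes "t \<in> {1..T}"
  shows "0 \<le> subopt_loss n (X t) (xs t) cstar"
  using subopt_loss_ge[OF X(1) X(2), of t n cstar "xs t"] assms by (simp add: ip_vsub_right)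

text \<open>\<open>cstar\<close> itself may be arbitrarily far from the origin, so \<open>Delta\<close> admits no bound in terms of
  \<open>T\<close>, \<open>B\<close>, \<open>D\<close>, \<open>K\<close>.  The learning rate is therefore tuned to the sum of the negative parts of the
  instantaneous regrets, which is bounded by \<open>Delta\<close> as well as by \<open>T * B\<close> and \<open>T * D * K\<close>.\<close>

definition neg_regret :: real where "neg_regret = (\<Sum>t=1..T. max 0 (- inst_regret t))"

lemma abs_inst_regret_le:
  assumes "t \<in> {1..T}"
  shows "\<bar>inst_regret t\<bar> \<le> B" "\<bar>inst_regret t\<bar> \<le> D * K"
  using assms by (auto simp: inst_regret_def intro!: abs_ip_g_le_B abs_ip_g_le_DK chat_in cstar)

lemma neg_regret_bounds: "neg_regret \<ge> 0" "neg_regret \<le> real T * B" "neg_regret \<le> real T * (D * K)"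
  "neg_regret \<le> (\<Sum>t=1..T. subopt_loss n (X t) (xs t) cstar)"
proof -
  show "neg_regret \<ge> 0" by (simp add: neg_regret_def sum_nonneg)
  have "max 0 (- inst_regret t) \<le> B" "max 0 (- inst_regret t) \<le> D * K" if "t \<in> {1..T}" for t
    using abs_inst_regret_le[OF that] by auto
  then show "neg_regret \<le> real T * B" "neg_regret \<le> real T * (D * K)"
    unfolding neg_regret_def using sum_bounded_above[of "{1..T}" "\<lambda>t. max 0 (- inst_regret t)"] by auto
  show "neg_regret \<le> (\<Sum>t=1..T. subopt_loss n (X t) (xs t) cstar)"
    unfolding neg_regret_def using neg_inst_regret_le_subopt_loss subopt_loss_nonneg by (intro sum_mono) simp
qed

text \<open>Bound one factor of each square by \<open>B\<close> and write the absolute value as the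
  number plus twice its negative part.\<close>

lemma sum_inst_regret_squared_le: "(\<Sum>t=1..T. (inst_regret t)\<^sup>2) \<le> B * ((\<Sum>t=1..T. inst_regret t) + 2 * neg_regret)"
proof -
  have "(inst_regret t)\<^sup>2 \<le> B * (inst_regret t + 2 * max 0 (- inst_regret t))" if "t \<in> {1..T}" for t
  proof -
    have "(inst_regret t)\<^sup>2 = \<bar>inst_regret t\<bar> * \<bar>inst_regret t\<bar>" by (simp add: power2_eq_square)
    also have "\<dots> \<le> B * \<bar>inst_regret t\<bar>" using abs_inst_regret_le(1)[OF that] by (intro mult_right_mono) auto
    also have "\<bar>inst_regret t\<bar> = inst_regret t + 2 * max 0 (- inst_regret t)" by auto
    finally show ?thesis .
  qed
  then have "(\<Sum>t=1..T. (inst_regret t)\<^sup>2) \<le> (\<Sum>t=1..T. B * (inst_regret t + 2 * max 0 (- inst_regret t)))"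
    by (rule sum_mono)
  then show ?thesis
    by (simp add: neg_regret_def sum_distrib_left[symmetric] sum.distrib)
qed

text \<open>The play \<open>chat t\<close> itself has surrogate loss 0. Hence minus the loss of
  \<open>cstar\<close> splits into the regret of the mixture against expert \<open>i\<close> and the
  regret of expert \<open>i\<close> against \<open>cstar\<close>.\<close>

lemma expert_regret:
  assumes i: "i \<le> mg_k T" and nT: "n \<le> T"
  shows "\<eta> i * (\<Sum>t=1..T. inst_regret t) - (\<eta> i)\<^sup>2 * (B * ((\<Sum>t=1..T. inst_regret t) + 2 * neg_regret))
    \<le> ln (1 / mg_prior T i) + 4 * (real n * L)"
proof -
  have "\<eta> i * (\<Sum>t=1..T. inst_regret t) - (\<eta> i)\<^sup>2 * (B * ((\<Sum>t=1..T. inst_regret t) + 2 * neg_regret))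
      \<le> \<eta> i * (\<Sum>t=1..T. inst_regret t) - (\<eta> i)\<^sup>2 * (\<Sum>t=1..T. (inst_regret t)\<^sup>2)"
    using sum_inst_regret_squared_le by (intro diff_left_mono mult_left_mono) auto
  also have "\<dots> = - (\<Sum>t=1..T. surrogate i t cstar)"
    by (simp add: surrogate_def inst_regret_def sum_subtractf sum_distrib_left sum_negf[symmetric])
  also have "\<dots> = - (\<Sum>t=1..T. surrogate i t (w i t)) + (\<Sum>t=1..T. surrogate i t (w i t) - surrogate i t cstar)"
    by (simp add: sum_subtractf)
  finally show ?thesis
    using expert_weight_bound[OF i] expert_ons_bound[OF i nT] by linarith
qed

lemma regret_le:
  "(\<Sum>t=1..T. inst_regret t) \<le> 102 * (B * (real n * L) + sqrt (neg_regret * (B * (real n * L))))"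
proof (cases "n \<le> T")
  case True
  have M: "real n * L \<ge> real n" "real n * L \<ge> L" "real n * L \<ge> 1"
    using L_ge_1 n mult_mono[of 1 "real n" 1 L] by auto
  \<comment> \<open>This bounds the grid index used in \<open>learning_rate_tuning\<close>, so the
    prior costs no extra term in \<open>T\<close>.\<close>
  have "neg_regret \<le> B * real n * exp L"
  proof -
    have "D * K * real T / (B * real n) \<le> exp L" by (simp add: exp_L)
    then show ?thesis using neg_regret_bounds(3) B n by (simp add: field_simps)
  qed
  also have "\<dots> \<le> B * (real n * L) * exp (real n * L)"
    using M B L_ge_1 by (intro mult_mono) auto
  finally show ?thesis
    using expert_regret True by (intro learning_rate_tuning[OF T B M(3) neg_regret_bounds(1,2)])
next
  \<comment> \<open>With fewer rounds than dimensions, \<open>T * B\<close> is already below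
    \<open>B * n * L\<close>.\<close>
  case False
  have "(\<Sum>t=1..T. inst_regret t) \<le> real T * B"
    using sum_bounded_above[of "{1..T}" inst_regret B] abs_inst_regret_le(1) by force
  also have "\<dots> \<le> B * (real n * L)"
    using False B L_ge_1 mult_mono[of "real T" "real n" 1 L] by simp
  also have "\<dots> \<le> 102 * (B * (real n * L) + sqrt (neg_regret * (B * (real n * L))))"
    using B L_ge_1 neg_regret_bounds(1) by simp
  finally show ?thesis .
qed

text \<open>In each round the two sides differ by \<open>ip n (chat t) (g t)\<close>, nonnegative by
  the choice of \<open>xhat t\<close>.\<close>

lemma linear_regret_le:
  "(\<Sum>t=1..T. ip n cstar (vsub (xs t) (xhat t))) \<le> (\<Sum>t=1..T. inst_regret t)"
proof (intro sum_mono)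
  fix t assume t: "t \<in> {1..T}"
  then show "ip n cstar (vsub (xs t) (xhat t)) \<le> inst_regret t"
    using xhat_argmax[OF t X(2)[OF t]] by (simp add: inst_regret_def g_def ip_vsub_left ip_vsub_right)
qed

lemma metagrad_regret:
  "(let Delta = (\<Sum>t=1..T. subopt_loss n (X t) (xs t) cstar);
        R = (\<Sum>t=1..T. ip n cstar (vsub (xs t) (xhat t)));
        Rt = (\<Sum>t=1..T. ip n (vsub (chat t) cstar) (vsub (xhat t) (xs t)));
        L = ln (max (exp 1) (D * K * real T / (B * real n)))
    in R \<le> Rt \<and> Rt \<le> 102 * (B * real n * L + sqrt (Delta * B * real n * L)))"
proof -
  let ?Delta = "\<Sum>t=1..T. subopt_loss n (X t) (xs t) cstar"
  \<comment> \<open>\<open>Delta\<close> enters only here, after the tuning, by monotonicity of the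
    square root.\<close>
  have "neg_regret * (B * (real n * L)) \<le> ?Delta * (B * (real n * L))"
    using neg_regret_bounds(4) B L_ge_1 by (intro mult_right_mono) auto
  then have "(\<Sum>t=1..T. inst_regret t) \<le> 102 * (B * real n * L + sqrt (?Delta * B * real n * L))"
    using regret_le by (smt (verit) real_sqrt_le_mono mult.assoc)
  then show ?thesis
    using linear_regret_le by (simp add: Let_def L_def inst_regret_def g_def)
qed

end

theorem theorem2:
  shows "\<exists>C>0. \<forall>(n::nat) (T::nat) (\<Theta>::(nat \<Rightarrow> real) set) (cstar::nat \<Rightarrow> real)
      (X::nat \<Rightarrow> (nat \<Rightarrow> real) set) (xs::nat \<Rightarrow> (nat \<Rightarrow> real)) (D::real) (K::real) (B::real)
      (chat::nat \<Rightarrow> (nat \<Rightarrow> real)) (xhat::nat \<Rightarrow> (nat \<Rightarrow> real))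
      (w::nat \<Rightarrow> nat \<Rightarrow> (nat \<Rightarrow> real)) (A::nat \<Rightarrow> nat \<Rightarrow> (nat \<Rightarrow> nat \<Rightarrow> real))
      (p::nat \<Rightarrow> nat \<Rightarrow> real).
    n > 0 \<and> T > 0 \<and>
    \<Theta> \<subseteq> Rn n \<and> closed \<Theta> \<and> convex_n \<Theta> \<and> cstar \<in> \<Theta> \<and>
    (\<forall>t\<in>{1..T}. X t \<subseteq> Rn n \<and> X t \<noteq> {} \<and> compact (X t) \<and> xs t \<in> X t) \<and>
    D > 0 \<and> K > 0 \<and> B > 0 \<and>
    (\<forall>c\<in>\<Theta>. \<forall>c'\<in>\<Theta>. l2dist n c c' \<le> D) \<and>
    (\<forall>t\<in>{1..T}. \<forall>x\<in>X t. \<forall>x'\<in>X t. l2dist n x x' \<le> K) \<and>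
    (\<forall>t\<in>{1..T}. \<forall>c\<in>\<Theta>. \<forall>c'\<in>\<Theta>. \<forall>x\<in>X t. \<forall>x'\<in>X t.
        ip n (vsub c c') (vsub x x') \<le> B) \<and>
    metagrad_run n T \<Theta> D B X xs chat xhat w A p
    \<longrightarrow>
    (let Delta = (\<Sum>t=1..T. subopt_loss n (X t) (xs t) cstar);
         R = (\<Sum>t=1..T. ip n cstar (vsub (xs t) (xhat t)));
         Rt = (\<Sum>t=1..T. ip n (vsub (chat t) cstar) (vsub (xhat t) (xs t)));
         L = ln (max (exp 1) (D * K * real T / (B * real n)))
     in R \<le> Rt \<and> Rt \<le> C * (B * real n * L + sqrt (Delta * B * real n * L)))"
proof (intro exI[of _ "102 :: real"] conjI allI impI)
  fix n T \<Theta> cstar X xs D K B chat xhat w A p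
  assume "n > 0 \<and> T > 0 \<and>
    \<Theta> \<subseteq> Rn n \<and> closed \<Theta> \<and> convex_n \<Theta> \<and> cstar \<in> \<Theta> \<and>
    (\<forall>t\<in>{1..T}. X t \<subseteq> Rn n \<and> X t \<noteq> {} \<and> compact (X t) \<and> xs t \<in> X t) \<and>
    D > 0 \<and> K > 0 \<and> B > 0 \<and>
    (\<forall>c\<in>\<Theta>. \<forall>c'\<in>\<Theta>. l2dist n c c' \<le> D) \<and>
    (\<forall>t\<in>{1..T}. \<forall>x\<in>X t. \<forall>x'\<in>X t. l2dist n x x' \<le> K) \<and>
    (\<forall>t\<in>{1..T}. \<forall>c\<in>\<Theta>. \<forall>c'\<in>\<Theta>. \<forall>x\<in>X t. \<forall>x'\<in>X t.
        ip n (vsub c c') (vsub x x') \<le> B) \<and>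
    metagrad_run n T \<Theta> D B X xs chat xhat w A p"
  then interpret metagrad n T \<Theta> cstar X xs D K B chat xhat w A p
    by unfold_locales auto
  show "let Delta = (\<Sum>t=1..T. subopt_loss n (X t) (xs t) cstar);
         R = (\<Sum>t=1..T. ip n cstar (vsub (xs t) (xhat t)));
         Rt = (\<Sum>t=1..T. ip n (vsub (chat t) cstar) (vsub (xhat t) (xs t)));
         L = ln (max (exp 1) (D * K * real T / (B * real n)))
     in R \<le> Rt \<and> Rt \<le> 102 * (B * real n * L + sqrt (Delta * B * real n * L))"
    by (rule metagrad_regret)
qed simp

end
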